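(* Let $K=SU(2)$ and $s>0$. Let $(k,\xi)\in SU(2)\times\mathfrak{su}(2)^*\cong T^*SU(2)$ with $\xi\neq0$, and let $h\in K$ and $\lambda=c\,t^*\in\mathfrak{t}^*_+$, $c>0$, be such that $\xi=\mathrm{Ad}_h^*\lambda$. Put $\gamma=\dfrac{1-e^{\sqrt2\,s\,c}}{2s}$ and $r_{K,s}=s\,x\wedge y$. Then the symplectic Poisson structure $\pi$ associated to $\mathcal{D}(\omega_{can})$ evaluated at $(k,\xi)$ is $$\pi(k,\xi)=-\Big(\frac1\gamma+\frac{\sqrt2}{c}\Big)(\mathrm{Ad}_hx)^L\wedge(\mathrm{Ad}_hy)^L+\sum_{b\in\mathcal{B}}b^L\wedge b^*-\frac12\sum_{a,b\in\mathcal{B}}\langle\xi,[a,b]\rangle\,a^*\wedge b^*+\big(\mathrm{Ad}_{kh}r_{K,s}-r_{K,s}\big)^R_k.$$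
   Context: $\mathcal{B}=\{x,y,t\}$ is the basis of $\mathfrak{su}(2)$ given by $$x=\frac1{2\sqrt2}\begin{pmatrix}0&1\\-1&0\end{pmatrix},\quad y=\frac{\sqrt{-1}}{2\sqrt2}\begin{pmatrix}0&1\\1&0\end{pmatrix},\quad t=\frac{\sqrt{-1}}{2\sqrt2}\begin{pmatrix}1&0\\0&-1\end{pmatrix},$$ orthonormal for $(X,Y)=-\kappa(X,Y)=-4\operatorname{Tr}(XY)$, with dual basis $\{x^*,y^*,t^*\}$ of $\mathfrak{su}(2)^*$. The positive Weyl chamber $\mathfrak{t}^*_+$ consists of nonnegative multiples of $t^*$. $AN\subset SL_2(\mathbb{C})$ is the group of upper triangular matrices of determinant one with positive real diagonal; $\langle X,Y\rangle_s=-\frac1s\operatorname{Im}(4\operatorname{Tr}(XY))$; $\Theta^L$ is the left-invariant Maurer-Cartan form on $AN$. $\phi\colon\mathfrak{su}(2)^*\to\mathfrak{su}(2)$ sends $x^*,y^*,t^*$ to $x,y,t$; $f\colon AN\to\exp(\sqrt{-1}\,\mathfrak{su}(2))$ is $f(b)=b\,\overline{b}^T$; $E_s(\lambda)=f^{-1}(\exp(2s\sqrt{-1}\,\phi(\lambda)))$. $T^*K\cong K\times\mathfrak{k}^*$ via left-invariant $1$-forms; $\omega_{can}=-d\theta_{taut}$; $\mu_L(k,\xi)=\mathrm{Ad}_k^*\xi$. Fix a closed $2$-form $\Omega^s$ on $\mathfrak{k}^*$ with $\Omega^s(X_{\mathfrak{k}^*},\cdot)=E_s^*\langle\Theta^L,X\rangle_s-d\langle\cdot,X\rangle$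 for all $X\in\mathfrak{k}$ ($X_{\mathfrak{k}^*}$ generates the coadjoint action); $\mathcal{D}(\omega_{can})=\omega_{can}+\mu_L^*\Omega^s$. The Poisson bivector $\pi$ is determined by $\pi^\sharp=-(\mathcal{D}(\omega_{can})^\flat)^{-1}$, with $\pi^\sharp(\alpha)=\pi(\alpha,\cdot)$ and $\omega^\flat(X)=\omega(X,\cdot)$. Superscripts $L$, $R$ denote left-, right-invariant extension of elements of $\mathfrak{k}$ or $\wedge^2\mathfrak{k}$ to (multi)vector fields on $K$, evaluated at $k$ and regarded as tangent to the first factor of $K\times\mathfrak{k}^*$; $b^*$ denotes the constant vector field on $\mathfrak{k}^*$.
   Formalization: With f(b) = b b̄^T and the left-invariant Θ^L no form Ω^s satisfies the stated identity, as Im Tr(b^{-1}XbX) would have to vanish; the theorem allows f(b) = b b̄^T or f(b) = b̄^T b, and its content lies in the second case. *)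

theory Defs
  imports "HOL-Analysis.Analysis"
begin

section \<open>Complex 2 by 2 matrices\<close>

type_synonym mat2 = "complex^2^2"

definition mat2 :: "complex \<Rightarrow> complex \<Rightarrow> complex \<Rightarrow> complex \<Rightarrow> mat2" where
  "mat2 a b c d = vector [vector [a, b], vector [c, d]]"

definition ctranspose :: "mat2 \<Rightarrow> mat2" where
  "ctranspose A = (\<chi> i j. cnj (A $ j $ i))"

(* The exponential from the library needs a Banach algebra, and mat2 with ** is not an instance. *)
definition mexp :: "mat2 \<Rightarrow> mat2" where
  "mexp A = (\<Sum>n. (1 / fact n) *\<^sub>R (((**) A ^^ n) (mat 1)))"

definition SU2 :: "mat2 set" where
  "SU2 = {k. ctranspose k ** k = mat 1 \<and> k ** ctranspose k = mat 1 \<and> det k = 1}"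

definition AN :: "mat2 set" where
  "AN = {b. b $ 2 $ 1 = 0 \<and> det b = 1 \<and>
            (\<forall>i. Im (b $ i $ i) = 0 \<and> Re (b $ i $ i) > 0)}"

lemma mat2_nth [simp]:
  "mat2 a b c d $ 1 $ 1 = a" "mat2 a b c d $ 1 $ 2 = b"
  "mat2 a b c d $ 2 $ 1 = c" "mat2 a b c d $ 2 $ 2 = d"
  by (simp_all add: mat2_def)

lemma ctranspose_nth [simp]: "ctranspose A $ i $ j = cnj (A $ j $ i)"
  by (simp add: ctranspose_def)

lemma mat2_eq_iff:
  "(A :: mat2) = B \<longleftrightarrow> A$1$1 = B$1$1 \<and> A$1$2 = B$1$2 \<and> A$2$1 = B$2$1 \<and> A$2$2 = B$2$2"
  by (auto simp: vec_eq_iff forall_2)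

lemma trace_mult_mat2:
  "trace ((A :: mat2) ** B)
     = A$1$1 * B$1$1 + A$1$2 * B$2$1 + (A$2$1 * B$1$2 + A$2$2 * B$2$2)"
  by (simp add: trace_def matrix_matrix_mult_def sum_2)

section \<open>The Lie algebra su(2) as a Euclidean space\<close>

typedef su2 = "{X :: mat2. ctranspose X = - X \<and> trace X = 0}"
  by (rule exI[of _ 0]) (simp add: mat2_eq_iff trace_def)

setup_lifting type_definition_su2

lemma su2_nth:
  "Rep_su2 X $ 2 $ 2 = - (Rep_su2 X $ 1 $ 1)"
  "Rep_su2 X $ 2 $ 1 = - cnj (Rep_su2 X $ 1 $ 2)"
  "Re (Rep_su2 X $ 1 $ 1) = 0"
proof -
  have *: "ctranspose (Rep_su2 X) = - Rep_su2 X" "trace (Rep_su2 X) = 0"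
    using Rep_su2[of X] by auto
  show "Rep_su2 X $ 2 $ 2 = - (Rep_su2 X $ 1 $ 1)"
    using *(2) by (simp add: trace_def sum_2 eq_neg_iff_add_eq_0 add.commute)
  show "Rep_su2 X $ 2 $ 1 = - cnj (Rep_su2 X $ 1 $ 2)"
    using *(1) by (simp add: mat2_eq_iff)
  have "cnj (Rep_su2 X $ 1 $ 1) = - (Rep_su2 X $ 1 $ 1)"
    using *(1) by (simp add: mat2_eq_iff)
  then show "Re (Rep_su2 X $ 1 $ 1) = 0"
    by (simp add: complex_eq_iff)
qed

instantiation su2 :: real_vector
begin
lift_definition zero_su2 :: su2 is 0
  by (simp add: mat2_eq_iff trace_def)
lift_definition plus_su2 :: "su2 \<Rightarrow> su2 \<Rightarrow> su2" is "(+)"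
  by (auto simp: mat2_eq_iff trace_add)
lift_definition minus_su2 :: "su2 \<Rightarrow> su2 \<Rightarrow> su2" is "(-)"
  by (auto simp: mat2_eq_iff trace_sub)
lift_definition uminus_su2 :: "su2 \<Rightarrow> su2" is "uminus"
  by (auto simp: mat2_eq_iff trace_def sum_negf)
lift_definition scaleR_su2 :: "real \<Rightarrow> su2 \<Rightarrow> su2" is "scaleR"
  by (auto simp: mat2_eq_iff trace_def scaleR_sum_right[symmetric] simp del: scaleR_sum_right)
instance
  by standard (transfer; simp add: algebra_simps)+
end

lift_definition x_su :: su2 is "mat2 0 (1 / (2 * sqrt 2)) (- 1 / (2 * sqrt 2)) 0"
  by (auto simp: mat2_eq_iff trace_def sum_2)
lift_definition y_su :: su2 is "mat2 0 (\<i> / (2 * sqrt 2)) (\<i> / (2 * sqrt 2)) 0"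
  by (auto simp: mat2_eq_iff trace_def sum_2)
lift_definition t_su :: su2 is "mat2 (\<i> / (2 * sqrt 2)) 0 0 (- \<i> / (2 * sqrt 2))"
  by (auto simp: mat2_eq_iff trace_def sum_2)

definition su2_basis :: "su2 set" where
  "su2_basis = {x_su, y_su, t_su}"

instantiation su2 :: real_inner
begin
definition inner_su2 :: "su2 \<Rightarrow> su2 \<Rightarrow> real" where
  "inner_su2 X Y = Re (- 4 * trace (Rep_su2 X ** Rep_su2 Y))"
definition norm_su2 :: "su2 \<Rightarrow> real" where "norm_su2 X = sqrt (inner X X)"
definition dist_su2 :: "su2 \<Rightarrow> su2 \<Rightarrow> real" where "dist_su2 X Y = norm (X - Y)"
definition sgn_su2 :: "su2 \<Rightarrow> su2" where "sgn_su2 X = X /\<^sub>R norm X"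
definition uniformity_su2 :: "(su2 \<times> su2) filter" where
  "uniformity_su2 = (INF e\<in>{0 <..}. principal {(X, Y). dist X Y < e})"
definition open_su2 :: "su2 set \<Rightarrow> bool" where
  "open_su2 U \<longleftrightarrow> (\<forall>X\<in>U. eventually (\<lambda>(X', Y). X' = X \<longrightarrow> Y \<in> U) uniformity)"

lemma inner_su2_nth:
  "inner X Y = 8 * (Im (Rep_su2 X $ 1 $ 1) * Im (Rep_su2 Y $ 1 $ 1)
     + Re (Rep_su2 X $ 1 $ 2) * Re (Rep_su2 Y $ 1 $ 2)
     + Im (Rep_su2 X $ 1 $ 2) * Im (Rep_su2 Y $ 1 $ 2))"
  unfolding inner_su2_def trace_mult_mat2 su2_nth by (simp add: su2_nth algebra_simps)

lemma su2_eq_iff: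
  "X = Y \<longleftrightarrow> Im (Rep_su2 X $ 1 $ 1) = Im (Rep_su2 Y $ 1 $ 1) \<and> Rep_su2 X $ 1 $ 2 = Rep_su2 Y $ 1 $ 2"
  unfolding Rep_su2_inject[symmetric] mat2_eq_iff
  by (auto simp: su2_nth complex_eq_iff)

instance
proof
  fix X Y Z :: su2 and r :: real
  show "inner X Y = inner Y X"
    unfolding inner_su2_nth by (simp add: algebra_simps)
  show "inner (X + Y) Z = inner X Z + inner Y Z"
    unfolding inner_su2_nth plus_su2.rep_eq by (simp add: algebra_simps)
  show "inner (r *\<^sub>R X) Y = r * inner X Y"
    unfolding inner_su2_nth scaleR_su2.rep_eq by (simp add: algebra_simps)
  show "0 \<le> inner X X"
    unfolding inner_su2_nth by simp
  have "inner X X = 8 * ((Im (Rep_su2 X $ 1 $ 1))\<^sup>2 + (Re (Rep_su2 X $ 1 $ 2))\<^sup>2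
     + (Im (Rep_su2 X $ 1 $ 2))\<^sup>2)"
    unfolding inner_su2_nth by (simp add: power2_eq_square)
  then show "(inner X X = 0) = (X = 0)"
    unfolding su2_eq_iff
    by (auto simp: zero_su2.rep_eq complex_eq_iff add_nonneg_eq_0_iff)
qed (simp_all add: norm_su2_def dist_su2_def sgn_su2_def uniformity_su2_def open_su2_def)
end

lemma su2_basis_inner:
  "inner x_su x_su = 1" "inner y_su y_su = 1" "inner t_su t_su = 1"
  "inner x_su y_su = 0" "inner x_su t_su = 0" "inner y_su t_su = 0"
  "inner y_su x_su = 0" "inner t_su x_su = 0" "inner t_su y_su = 0"
  unfolding inner_su2_nth x_su.rep_eq y_su.rep_eq t_su.rep_eq
  by (simp_all add: Re_divide Im_divide power2_eq_square field_simps)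

instantiation su2 :: euclidean_space
begin
definition Basis_su2 :: "su2 set" where "Basis_su2 = su2_basis"
instance
proof
  show "(Basis :: su2 set) \<noteq> {}" "finite (Basis :: su2 set)"
    by (simp_all add: Basis_su2_def su2_basis_def)
  have ne: "x_su \<noteq> y_su" "x_su \<noteq> t_su" "y_su \<noteq> t_su"
    using su2_basis_inner by force+
  show "inner u v = (if u = v then 1 else 0)" if "u \<in> Basis" "v \<in> Basis" for u v :: su2
    using that ne ne[symmetric] by (auto simp: Basis_su2_def su2_basis_def su2_basis_inner)
  show "(\<forall>u\<in>Basis. inner X u = 0) \<longleftrightarrow> X = 0" for X :: su2
    unfolding Basis_su2_def su2_basis_def su2_eq_iff
    by (auto simp: inner_su2_nth x_su.rep_eq y_su.rep_eq t_su.rep_eq zero_su2.rep_eq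
        complex_eq_iff Re_divide Im_divide power2_eq_square)
qed
end

type_synonym su2_dual = "su2 \<Rightarrow>\<^sub>L real"

definition lie_bracket :: "su2 \<Rightarrow> su2 \<Rightarrow> su2" where
  "lie_bracket X Y = Abs_su2 (Rep_su2 X ** Rep_su2 Y - Rep_su2 Y ** Rep_su2 X)"

(* x*, y*, t* are dual_basis x_su, dual_basis y_su, dual_basis t_su. *)
definition dual_basis :: "su2 \<Rightarrow> su2_dual" where
  "dual_basis b = blinfun_inner_right b"

lemma dual_basis_dual:
  assumes "a \<in> su2_basis" "b \<in> su2_basis"
  shows "blinfun_apply (dual_basis b) a = (if a = b then 1 else 0)"
  using assms inner_Basis[of b a] by (auto simp: dual_basis_def Basis_su2_def)

definition weyl_chamber :: "su2_dual set" where
  "weyl_chamber = {c *\<^sub>R dual_basis t_su | c. c \<ge> 0}"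

(* Ad and coAd are meaningful for k in SU2. *)
definition Ad :: "mat2 \<Rightarrow> su2 \<Rightarrow>\<^sub>L su2" where
  "Ad k = Blinfun (\<lambda>X. Abs_su2 (k ** Rep_su2 X ** matrix_inv k))"

definition coAd :: "mat2 \<Rightarrow> su2_dual \<Rightarrow> su2_dual" where
  "coAd k \<xi> = \<xi> o\<^sub>L Ad (matrix_inv k)"

section \<open>Bilinear maps, 2-forms and bivectors on a finite-dimensional space\<close>

(* A 2-form on V is an alternating element of 'V form2. A bivector P in V wedge V is identified with
   the alternating bilinear map (\<alpha>, \<beta>) |-> P(\<alpha>, \<beta>) on the dual space. *)
type_synonym 'a form2 = "'a \<Rightarrow>\<^sub>L 'a \<Rightarrow>\<^sub>L real"
type_synonym 'a bivector = "('a \<Rightarrow>\<^sub>L real) form2"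

definition bilin :: "('a::real_normed_vector \<Rightarrow> 'b::real_normed_vector \<Rightarrow> 'c::real_normed_vector)
    \<Rightarrow> ('a \<Rightarrow>\<^sub>L 'b \<Rightarrow>\<^sub>L 'c)" where
  "bilin F = Blinfun (\<lambda>u. Blinfun (F u))"

lemma bilin_apply:
  assumes "bounded_bilinear F"
  shows "blinfun_apply (blinfun_apply (bilin F) u) v = F u v"
proof -
  interpret bounded_bilinear F by fact
  have app: "blinfun_apply (Blinfun (F u)) = F u" for u
    by (rule bounded_linear_Blinfun_apply) (rule bounded_linear_right)
  obtain K where K: "0 \<le> K" "\<And>a b. norm (F a b) \<le> norm a * norm b * K"
    using nonneg_bounded by blast
  have "bounded_linear (\<lambda>u. Blinfun (F u))"
  proof (rule bounded_linear_intro[where K = K])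
    fix a :: 'a
    show "norm (Blinfun (F a)) \<le> norm a * K"
      by (rule norm_blinfun_bound) (use K in \<open>auto simp: app ac_simps\<close>)
  qed (auto intro!: blinfun_eqI simp: app blinfun.bilinear_simps add_left scaleR_left)
  then show ?thesis
    by (simp add: bilin_def bounded_linear_Blinfun_apply app)
qed

definition wedge :: "'a::real_normed_vector \<Rightarrow> 'a \<Rightarrow> 'a bivector" where
  "wedge u v = bilin (\<lambda>\<alpha> \<beta>. blinfun_apply \<alpha> u * blinfun_apply \<beta> v
                          - blinfun_apply \<alpha> v * blinfun_apply \<beta> u)"

definition push_bivector ::
    "('a::real_normed_vector \<Rightarrow>\<^sub>L 'b::real_normed_vector) \<Rightarrow> 'a bivector \<Rightarrow> 'b bivector" where
  "push_bivector A P = bilin (\<lambda>\<alpha> \<beta>. blinfun_apply (blinfun_apply P (\<alpha> o\<^sub>L A)) (\<beta> o\<^sub>L A))"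

(* blinfun_apply \<omega> is the map v |-> \<omega>(v, -) into the dual space, i.e. "omega flat"; for a
   nondegenerate \<omega> the bivector has sharp map \<alpha> |-> \<pi>(\<alpha>, -) = - (omega flat)^{-1} \<alpha>. *)
definition poisson_bivector :: "('a::real_normed_vector) form2 \<Rightarrow> 'a bivector" where
  "poisson_bivector \<omega> =
     bilin (\<lambda>\<alpha> \<beta>. blinfun_apply \<beta> (- inv (blinfun_apply \<omega>) \<alpha>))"

section \<open>Smooth closed 2-forms on a finite-dimensional vector space\<close>

fun times_differentiable ::
    "nat \<Rightarrow> ('a::real_normed_vector \<Rightarrow> 'b::real_normed_vector) \<Rightarrow> bool" where
  "times_differentiable 0 f = continuous_on UNIV f"
| "times_differentiable (Suc n) f \<longleftrightarrow> (\<forall>x. f differentiable (at x)) \<and>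
     (\<forall>v. times_differentiable n (\<lambda>x. frechet_derivative f (at x) v))"

definition smooth :: "('a::real_normed_vector \<Rightarrow> 'b::real_normed_vector) \<Rightarrow> bool" where
  "smooth f \<longleftrightarrow> (\<forall>n. times_differentiable n f)"

definition closed_2form :: "('a::real_normed_vector \<Rightarrow> 'a form2) \<Rightarrow> bool" where
  "closed_2form \<Omega> \<longleftrightarrow> smooth \<Omega> \<and> (\<forall>x u. blinfun_apply (blinfun_apply (\<Omega> x) u) u = 0) \<and>
     (\<forall>x u v w.
        blinfun_apply (blinfun_apply (frechet_derivative \<Omega> (at x) u) v) w
      - blinfun_apply (blinfun_apply (frechet_derivative \<Omega> (at x) v) u) w
      + blinfun_apply (blinfun_apply (frechet_derivative \<Omega> (at x) w) u) v = 0)"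

section \<open>Calculus on the cotangent bundle of SU(2)\<close>

(* T*K is K x su(2)*, (k, \<xi>) being the covector V |-> \<xi>(k^{-1} V) at k. Tangent vectors are written
   in the left trivialization: (X, \<eta>) at (k, \<xi>) is the velocity at time 0 of
   \<tau> |-> (k exp(\<tau> X), \<xi> + \<tau> \<eta>), so its K-component is the tangent vector k X in T_k K. *)
type_synonym cot_point = "mat2 \<times> su2_dual"
type_synonym cot_tangent = "su2 \<times> su2_dual"

definition left_triv :: "mat2 \<Rightarrow> mat2 \<Rightarrow> su2" where
  "left_triv k V = Abs_su2 (matrix_inv k ** V)"

(* The values at k of the invariant vector fields, k X and X k as tangent vectors of K. *)
definition left_ext :: "mat2 \<Rightarrow> su2 \<Rightarrow>\<^sub>L cot_tangent" where
  "left_ext k = Blinfun (\<lambda>X. (left_triv k (k ** Rep_su2 X), 0))"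

definition right_ext :: "mat2 \<Rightarrow> su2 \<Rightarrow>\<^sub>L cot_tangent" where
  "right_ext k = Blinfun (\<lambda>X. (left_triv k (Rep_su2 X ** k), 0))"

definition const_field :: "su2_dual \<Rightarrow> cot_tangent" where
  "const_field \<eta> = (0, \<eta>)"

definition flow_line :: "cot_point \<Rightarrow> cot_tangent \<Rightarrow> real \<Rightarrow> cot_point" where
  "flow_line p v \<tau> = (fst p ** mexp (\<tau> *\<^sub>R Rep_su2 (fst v)), snd p + \<tau> *\<^sub>R snd v)"

definition dir_deriv ::
    "(cot_point \<Rightarrow> 'a::real_normed_vector) \<Rightarrow> cot_point \<Rightarrow> cot_tangent \<Rightarrow> 'a" where
  "dir_deriv F p v = vector_derivative (\<lambda>\<tau>. F (flow_line p v \<tau>)) (at 0)"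

(* d\<theta>(U, V) = U \<theta>(V) - V \<theta>(U) - \<theta>([U, V]), taken on the vector fields U and V that are constant
   in the left trivialization; there [U, V] is given by the bracket of su(2). *)
definition ext_deriv :: "(cot_point \<Rightarrow> cot_tangent \<Rightarrow> real) \<Rightarrow> cot_point \<Rightarrow> cot_tangent form2" where
  "ext_deriv \<theta> p = bilin (\<lambda>u v.
      dir_deriv (\<lambda>q. \<theta> q v) p u - dir_deriv (\<lambda>q. \<theta> q u) p v
      - \<theta> p (lie_bracket (fst u) (fst v), 0))"

(* The covector (k, \<xi>) applied to the projection k X of the tangent vector (X, \<eta>). *)
definition theta_taut :: "cot_point \<Rightarrow> cot_tangent \<Rightarrow> real" where
  "theta_taut p v =
     blinfun_apply (snd p) (left_triv (fst p) (fst p ** Rep_su2 (fst v)))"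

definition omega_can :: "cot_point \<Rightarrow> cot_tangent form2" where
  "omega_can p = - ext_deriv theta_taut p"

definition mu_L :: "cot_point \<Rightarrow> su2_dual" where
  "mu_L p = coAd (fst p) (snd p)"

definition pullback_mu_L :: "(su2_dual \<Rightarrow> su2_dual form2) \<Rightarrow> cot_point \<Rightarrow> cot_tangent form2" where
  "pullback_mu_L \<Omega> p = bilin (\<lambda>u v.
     blinfun_apply (blinfun_apply (\<Omega> (mu_L p)) (dir_deriv mu_L p u)) (dir_deriv mu_L p v))"

section \<open>The deformed symplectic form\<close>

definition phi :: "su2_dual \<Rightarrow> su2" where
  "phi \<xi> = (\<Sum>b\<in>su2_basis. blinfun_apply \<xi> b *\<^sub>R b)"

(* The map f from AN to exp(i su(2)) is a parameter; see f_convention. *)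
definition E_map :: "(mat2 \<Rightarrow> mat2) \<Rightarrow> real \<Rightarrow> su2_dual \<Rightarrow> mat2" where
  "E_map f s \<xi> = inv_into AN f (mexp (mat (2 * of_real s * \<i>) ** Rep_su2 (phi \<xi>)))"

(* Two conventions for f. With f b = b b^* and the left-invariant form \<Theta>^L below, no \<Omega> satisfies
   deforming_form: its identity at \<eta> = the generating vector field of X itself forces
   Im (Tr (b^{-1} X b X)) = 0 for all b in AN and X in su(2), which fails for X a multiple of x_su
   and b with corner entry z, Im (z^2) not 0. With f b = b^* b the identity is solvable.
   A result stated for both conventions covers the first one literally and is not vacuous. *)
definition f_convention :: "(mat2 \<Rightarrow> mat2) \<Rightarrow> bool" where
  "f_convention f \<longleftrightarrow> f = (\<lambda>b. b ** ctranspose b) \<or> f = (\<lambda>b. ctranspose b ** b)"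

definition pairing :: "real \<Rightarrow> mat2 \<Rightarrow> mat2 \<Rightarrow> real" where
  "pairing s A B = - (1 / s) * Im (4 * trace (A ** B))"

definition maurer_cartan_L :: "mat2 \<Rightarrow> mat2 \<Rightarrow> mat2" where
  "maurer_cartan_L b V = matrix_inv b ** V"

definition coad_generator :: "su2 \<Rightarrow> su2_dual \<Rightarrow> su2_dual" where
  "coad_generator X \<xi> = vector_derivative (\<lambda>\<tau>. coAd (mexp (\<tau> *\<^sub>R Rep_su2 X)) \<xi>) (at 0)"

definition deforming_form ::
    "(mat2 \<Rightarrow> mat2) \<Rightarrow> real \<Rightarrow> (su2_dual \<Rightarrow> su2_dual form2) \<Rightarrow> bool" where
  "deforming_form f s \<Omega> \<longleftrightarrow> closed_2form \<Omega> \<and>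
     (\<forall>X \<xi> \<eta>. blinfun_apply (blinfun_apply (\<Omega> \<xi>) (coad_generator X \<xi>)) \<eta> =
        pairing s (maurer_cartan_L (E_map f s \<xi>) (frechet_derivative (E_map f s) (at \<xi>) \<eta>))
          (Rep_su2 X)
        - frechet_derivative (\<lambda>\<zeta>. blinfun_apply \<zeta> X) (at \<xi>) \<eta>)"

definition deform ::
    "(su2_dual \<Rightarrow> su2_dual form2) \<Rightarrow> (cot_point \<Rightarrow> cot_tangent form2) \<Rightarrow>
     cot_point \<Rightarrow> cot_tangent form2" where
  "deform \<Omega> \<omega> p = \<omega> p + pullback_mu_L \<Omega> p"

definition r_matrix :: "real \<Rightarrow> su2 bivector" where
  "r_matrix s = s *\<^sub>R wedge x_su y_su"

end

(* Identify su(2)* with su(2) through the inner product; the bracket is then the cross product divided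
   by sqrt 2. Of the two conventions for f only f b = b^* b admits a deforming form, and there
   E_s is computed from the closed form of the exponential of a traceless Hermitian matrix. The defining
   identity fixes \<Omega> on the coadjoint orbit directions, hence everywhere by skew-symmetry, and at the
   point v one gets \<Omega>(a + [B a, v], w) = - <w, B a>, where B a = sqrt 2 [m v - s t, a] with
   m = (s |v| coth (s |v| / sqrt 2) - sqrt 2) / |v|^2. For a covector (p, q) this makes
   (B p - q, p + [q, v]), with v = \<xi> and t replaced by Ad_{k^{-1}} t, the vector to which the
   deformed form assigns -(p, q); it is also the contraction of the claimed bivector with (p, q),
   because m = (s - 1/\<gamma> - sqrt 2/c) / c. *)

theory Submission
  imports Defs
begin

text \<open>The inverse of the deformed form is guessed and verified, not computed. The canonical
  form alone is inverted on (p, q) by (-q, p + [q, v]). The vector (-q, [q, v]) generates right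
  translations, along which \<open>mu_L\<close> is constant. Adding B p to the first slot changes
  the canonical form on (Z, z) by <z + [Z, v], B p>, and up to Ad_k the vector z + [Z, v] is the
  image of (Z, z) under the derivative of \<open>mu_L\<close>. So the correction succeeds as soon as
  \<Omega>(p + [B p, v], w) = - <w, B p> for all w. By the defining identity of \<Omega> this means
  \<Omega>(a, w) = - MC(w, B a), where MC(w, X) is the pairing of X with the Maurer-Cartan form
  along w: linear equations for B, whose solution is verified below. The norm is not differentiable
  at 0, so E is differentiated at nonzero points only; the point \<xi> and its translates Ad_k \<xi>
  are of this kind. Two choice operators have to be tamed: \<open>inv_into\<close> in E, by
  uniqueness of the Cholesky factor, and \<open>inv\<close> in the Poisson bivector, by
  skew-symmetry.\<close>

section \<open>Orthonormal coordinates and the bracket of su(2)\<close>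

lemma su2_basis_distinct: "x_su \<noteq> y_su" "x_su \<noteq> t_su" "y_su \<noteq> t_su"
  using su2_basis_inner by force+

lemma sum_su2_basis: "(\<Sum>b\<in>su2_basis. g b) = g x_su + g y_su + g t_su"
  for g :: "su2 \<Rightarrow> 'a::comm_monoid_add"
  using su2_basis_distinct by (simp add: su2_basis_def add.assoc)

lemma inner_su2_coords:
  "inner X Y = inner X x_su * inner Y x_su + inner X y_su * inner Y y_su + inner X t_su * inner Y t_su"
  by (subst euclidean_inner) (simp add: Basis_su2_def sum_su2_basis)

lemma norm_su2_coords:
  "(norm X)\<^sup>2 = (inner X x_su)\<^sup>2 + (inner X y_su)\<^sup>2 + (inner X t_su)\<^sup>2" for X :: su2
  unfolding power2_norm_eq_inner by (subst inner_su2_coords) (simp add: power2_eq_square)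

lemma su2_eq_iff_coords:
  "X = Y \<longleftrightarrow> inner X x_su = inner Y x_su \<and> inner X y_su = inner Y y_su \<and> inner X t_su = inner Y t_su"
  by (subst euclidean_eq_iff) (simp add: Basis_su2_def su2_basis_def)

lemma Rep_su2_coords:
  "Rep_su2 X $ 1 $ 1 = Complex 0 (inner X t_su / (2 * sqrt 2))"
  "Rep_su2 X $ 1 $ 2 = Complex (inner X x_su / (2 * sqrt 2)) (inner X y_su / (2 * sqrt 2))"
  "Rep_su2 X $ 2 $ 1 = Complex (- inner X x_su / (2 * sqrt 2)) (inner X y_su / (2 * sqrt 2))"
  "Rep_su2 X $ 2 $ 2 = Complex 0 (- inner X t_su / (2 * sqrt 2))"
  by (simp_all add: complex_eq_iff su2_nth inner_su2_nth x_su.rep_eq y_su.rep_eq t_su.rep_eq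
      Re_divide Im_divide power2_eq_square field_simps)

lemma Rep_su2_lie_bracket:
  "Rep_su2 (lie_bracket X Y) = Rep_su2 X ** Rep_su2 Y - Rep_su2 Y ** Rep_su2 X"
  unfolding lie_bracket_def
  by (rule Abs_su2_inverse)
    (simp add: mat2_eq_iff trace_def sum_2 matrix_matrix_mult_def su2_nth complex_eq_iff algebra_simps)

text \<open>Clearing the factors \<open>2 * sqrt 2\<close> of the basis matrices leaves sqrt 2 twice
  in a right-nested product; this is the rewrite rule for that shape.\<close>

lemma sqrt_2_mult: "sqrt 2 * (sqrt 2 * a) = 2 * a"
  by (simp flip: mult.assoc)

lemma lie_bracket_coords:
  "inner (lie_bracket X Y) x_su = (inner X y_su * inner Y t_su - inner X t_su * inner Y y_su) / sqrt 2"
  "inner (lie_bracket X Y) y_su = (inner X t_su * inner Y x_su - inner X x_su * inner Y t_su) / sqrt 2"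
  "inner (lie_bracket X Y) t_su = (inner X x_su * inner Y y_su - inner X y_su * inner Y x_su) / sqrt 2"
proof -
  have eqs: "inner (lie_bracket X Y) x_su = 2 * sqrt 2 * Re (Rep_su2 (lie_bracket X Y) $ 1 $ 2)"
    "inner (lie_bracket X Y) y_su = 2 * sqrt 2 * Im (Rep_su2 (lie_bracket X Y) $ 1 $ 2)"
    "inner (lie_bracket X Y) t_su = 2 * sqrt 2 * Im (Rep_su2 (lie_bracket X Y) $ 1 $ 1)"
    by (simp_all only: Rep_su2_coords complex.sel) simp_all
  show "inner (lie_bracket X Y) x_su = (inner X y_su * inner Y t_su - inner X t_su * inner Y y_su) / sqrt 2"
    "inner (lie_bracket X Y) y_su = (inner X t_su * inner Y x_su - inner X x_su * inner Y t_su) / sqrt 2"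
    "inner (lie_bracket X Y) t_su = (inner X x_su * inner Y y_su - inner X y_su * inner Y x_su) / sqrt 2"
    unfolding eqs Rep_su2_lie_bracket
    by (simp_all add: matrix_matrix_mult_def sum_2 Rep_su2_coords field_simps sqrt_2_mult)
qed

lemma bounded_bilinear_lie_bracket: "bounded_bilinear lie_bracket"
proof -
  have "bilinear lie_bracket"
    unfolding bilinear_def
    by (auto intro!: linearI simp: su2_eq_iff_coords lie_bracket_coords inner_left_distrib field_simps)
  then show ?thesis
    by (simp add: bilinear_conv_bounded_bilinear)
qed

interpretation lie_bracket: bounded_bilinear lie_bracket
  by (rule bounded_bilinear_lie_bracket)

lemma lie_bracket_anticommute: "lie_bracket X Y = - lie_bracket Y X"
  by (simp add: su2_eq_iff_coords lie_bracket_coords field_simps)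

text \<open>Ad-invariance of the inner product; in coordinates, the cyclic symmetry of the triple
  product.\<close>

lemma inner_lie_bracket_cycle: "inner (lie_bracket X Y) Z = inner X (lie_bracket Y Z)"
  by (subst (1 2) inner_su2_coords) (simp add: lie_bracket_coords field_simps)

section \<open>The identification of su(2) with its dual\<close>

lemma dual_basis_apply [simp]: "blinfun_apply (dual_basis v) X = inner v X"
  by (simp add: dual_basis_def)

text \<open>From here on \<open>dual_basis\<close> is applied to arbitrary vectors, as the Riesz
  map. Orthonormality of the basis makes \<open>phi\<close> its inverse, so every covector has the
  form \<open>dual_basis v\<close>.\<close>

lemma inner_phi: "inner (phi \<zeta>) X = blinfun_apply \<zeta> X"
proof -
  have "blinfun_apply \<zeta> X = blinfun_apply \<zeta> (\<Sum>b\<in>Basis. inner X b *\<^sub>R b)"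
    by (simp add: euclidean_representation)
  also have "\<dots> = inner (phi \<zeta>) X"
    unfolding phi_def Basis_su2_def
    by (simp add: blinfun.bilinear_simps blinfun.sum_right inner_sum_left inner_commute[of X] mult.commute)
  finally show ?thesis ..
qed

lemma dual_basis_phi [simp]: "dual_basis (phi \<zeta>) = \<zeta>"
  by (rule blinfun_eqI) (simp add: inner_phi)

lemma phi_dual_basis [simp]: "phi (dual_basis v) = v"
proof -
  have "inner (phi (dual_basis v)) X = inner v X" for X
    by (simp add: inner_phi)
  then show ?thesis
    by (metis vector_eq_rdot)
qed

lemma bounded_linear_dual_basis: "bounded_linear dual_basis"
  unfolding dual_basis_def by (intro bounded_linear_blinfun_inner_right bounded_linear_ident)

lemma bounded_linear_phi: "bounded_linear phi"
  unfolding phi_def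
  by (intro bounded_linear_sum bounded_linear_scaleR_const blinfun.bounded_linear_left)

section \<open>SU(2) and its adjoint and coadjoint actions\<close>

lemma matrix_inv_eqI:
  fixes A :: "'a::semiring_1^'n^'n"
  assumes "A ** B = mat 1" "B ** A = mat 1"
  shows "matrix_inv A = B"
proof -
  have "invertible A"
    using assms by (auto simp: invertible_def)
  then have "matrix_inv A ** A = mat 1"
    unfolding matrix_inv_def invertible_def by (rule someI2_ex) simp
  then have "matrix_inv A ** (A ** B) = B"
    by (simp add: matrix_mul_assoc)
  then show ?thesis
    by (simp add: assms(1))
qed

lemma matrix_inv_SU2: "k \<in> SU2 \<Longrightarrow> matrix_inv k = ctranspose k"
  by (rule matrix_inv_eqI) (auto simp: SU2_def)

lemma ctranspose_mult: "ctranspose (A ** B) = ctranspose B ** ctranspose A"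
  by (simp add: mat2_eq_iff matrix_matrix_mult_def sum_2 mult.commute)

lemma ctranspose_ctranspose [simp]: "ctranspose (ctranspose A) = A"
  by (simp add: mat2_eq_iff)

lemma det_ctranspose: "det (ctranspose A) = cnj (det A)"
  by (simp add: det_2 mult.commute)

lemma SU2_ctranspose: "k \<in> SU2 \<Longrightarrow> ctranspose k \<in> SU2"
  by (simp add: SU2_def det_ctranspose)

lemma SU2_mult:
  assumes "k \<in> SU2" "l \<in> SU2"
  shows "k ** l \<in> SU2"
proof -
  have "ctranspose l ** ctranspose k ** (k ** l) = ctranspose l ** (ctranspose k ** k) ** l"
    "k ** l ** (ctranspose l ** ctranspose k) = k ** (l ** ctranspose l) ** ctranspose k"
    by (simp_all add: matrix_mul_assoc)
  then show ?thesis
    using assms by (simp add: SU2_def ctranspose_mult det_mul)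
qed

text \<open>Conjugation by a unitary matrix keeps a matrix skew-Hermitian and traceless; this
  membership is what allows \<open>Abs_su2\<close> to be undone.\<close>

lemma conj_su2:
  assumes "k \<in> SU2"
  shows "Rep_su2 (Abs_su2 (k ** Rep_su2 X ** matrix_inv k)) = k ** Rep_su2 X ** ctranspose k"
proof -
  have X: "ctranspose (Rep_su2 X) = - Rep_su2 X" "trace (Rep_su2 X) = 0"
    using Rep_su2[of X] by auto
  have "ctranspose (k ** Rep_su2 X ** ctranspose k) = k ** (- Rep_su2 X) ** ctranspose k"
    by (simp add: ctranspose_mult X matrix_mul_assoc)
  also have "\<dots> = - (k ** Rep_su2 X ** ctranspose k)"
    by (simp add: mat2_eq_iff matrix_matrix_mult_def sum_2 algebra_simps)
  finally have 1: "ctranspose (k ** Rep_su2 X ** ctranspose k) = - (k ** Rep_su2 X ** ctranspose k)" .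
  have "trace (k ** Rep_su2 X ** ctranspose k) = trace (ctranspose k ** (k ** Rep_su2 X))"
    by (rule trace_mul_sym)
  also have "\<dots> = 0"
    using assms X by (simp add: SU2_def matrix_mul_assoc)
  finally show ?thesis
    using 1 by (simp add: Abs_su2_inverse matrix_inv_SU2[OF assms])
qed

lemma Ad_apply:
  assumes "k \<in> SU2"
  shows "blinfun_apply (Ad k) X = Abs_su2 (k ** Rep_su2 X ** matrix_inv k)"
proof -
  have "linear (\<lambda>X. Abs_su2 (k ** Rep_su2 X ** matrix_inv k))"
  proof (rule linearI)
    fix X Y :: su2 and r :: real
    show "Abs_su2 (k ** Rep_su2 (X + Y) ** matrix_inv k) =
        Abs_su2 (k ** Rep_su2 X ** matrix_inv k) + Abs_su2 (k ** Rep_su2 Y ** matrix_inv k)"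
      unfolding Rep_su2_inject[symmetric] plus_su2.rep_eq[of "Abs_su2 _"] conj_su2[OF assms]
      unfolding plus_su2.rep_eq
      by (simp add: mat2_eq_iff matrix_matrix_mult_def sum_2 algebra_simps)
    show "Abs_su2 (k ** Rep_su2 (r *\<^sub>R X) ** matrix_inv k) =
        r *\<^sub>R Abs_su2 (k ** Rep_su2 X ** matrix_inv k)"
      unfolding Rep_su2_inject[symmetric] scaleR_su2.rep_eq[of _ "Abs_su2 _"] conj_su2[OF assms]
      unfolding scaleR_su2.rep_eq
      by (simp add: mat2_eq_iff matrix_matrix_mult_def sum_2 algebra_simps)
  qed
  then show ?thesis
    by (simp add: Ad_def bounded_linear_Blinfun_apply linear_conv_bounded_linear)
qed

lemma Rep_su2_Ad: "k \<in> SU2 \<Longrightarrow> Rep_su2 (blinfun_apply (Ad k) X) = k ** Rep_su2 X ** ctranspose k"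
  by (simp add: Ad_apply conj_su2)

lemma Ad_mult:
  "k \<in> SU2 \<Longrightarrow> l \<in> SU2 \<Longrightarrow> blinfun_apply (Ad (k ** l)) X = blinfun_apply (Ad k) (blinfun_apply (Ad l) X)"
  by (simp add: Rep_su2_inject[symmetric] Rep_su2_Ad SU2_mult ctranspose_mult matrix_mul_assoc)

lemma Ad_ctranspose_inverse:
  assumes "k \<in> SU2"
  shows "blinfun_apply (Ad (ctranspose k)) (blinfun_apply (Ad k) X) = X"
    and "blinfun_apply (Ad k) (blinfun_apply (Ad (ctranspose k)) X) = X"
proof -
  have 1: "ctranspose (mat 1) = mat 1"
    by (simp add: mat2_eq_iff mat_def)
  then have "mat 1 \<in> SU2"
    by (simp add: SU2_def)
  then have "Ad (mat 1) X = X"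
    by (simp add: Rep_su2_inject[symmetric] Rep_su2_Ad 1)
  then show "blinfun_apply (Ad (ctranspose k)) (blinfun_apply (Ad k) X) = X"
    "blinfun_apply (Ad k) (blinfun_apply (Ad (ctranspose k)) X) = X"
    using assms by (simp_all add: Ad_mult[symmetric] SU2_ctranspose) (simp_all add: SU2_def)
qed

text \<open>Cyclicity of the trace brings \<open>ctranspose k\<close> to the front, where it cancels
  \<open>k\<close>.\<close>

lemma inner_Ad:
  assumes "k \<in> SU2"
  shows "inner (blinfun_apply (Ad k) X) (blinfun_apply (Ad k) Y) = inner X Y"
proof -
  have "trace (k ** Rep_su2 X ** ctranspose k ** (k ** Rep_su2 Y ** ctranspose k))
      = trace ((k ** Rep_su2 X ** (ctranspose k ** k) ** Rep_su2 Y) ** ctranspose k)"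
    by (simp add: matrix_mul_assoc)
  also have "\<dots> = trace (ctranspose k ** (k ** Rep_su2 X ** (ctranspose k ** k) ** Rep_su2 Y))"
    by (rule trace_mul_sym)
  also have "\<dots> = trace (Rep_su2 X ** Rep_su2 Y)"
    using assms by (simp add: SU2_def matrix_mul_assoc)
  finally show ?thesis
    by (simp add: inner_su2_def Rep_su2_Ad[OF assms])
qed

lemma inner_Ad_left:
  "k \<in> SU2 \<Longrightarrow> inner (blinfun_apply (Ad k) X) Y = inner X (blinfun_apply (Ad (ctranspose k)) Y)"
  by (metis inner_Ad Ad_ctranspose_inverse(2))

lemma Ad_lie_bracket:
  assumes "k \<in> SU2"
  shows "blinfun_apply (Ad k) (lie_bracket X Y) =
    lie_bracket (blinfun_apply (Ad k) X) (blinfun_apply (Ad k) Y)"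
proof -
  have "k ** Rep_su2 X ** ctranspose k ** (k ** Rep_su2 Y ** ctranspose k)
      = k ** Rep_su2 X ** (ctranspose k ** k) ** Rep_su2 Y ** ctranspose k" for X Y
    by (simp add: matrix_mul_assoc)
  moreover have "ctranspose k ** k = mat 1"
    using assms by (simp add: SU2_def)
  ultimately have *: "k ** Rep_su2 X ** ctranspose k ** (k ** Rep_su2 Y ** ctranspose k)
      = k ** (Rep_su2 X ** Rep_su2 Y) ** ctranspose k" for X Y
    by (simp only: matrix_mul_rid) (simp only: matrix_mul_assoc)
  show ?thesis
    unfolding Rep_su2_inject[symmetric] Rep_su2_lie_bracket Rep_su2_Ad[OF assms] *
    by (simp add: mat2_eq_iff matrix_matrix_mult_def sum_2 algebra_simps)
qed

text \<open>Since Ad k is orthogonal, the inverse in the coadjoint action is undone by passing to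
  the adjoint map: under the Riesz identification both actions agree.\<close>

lemma coAd_dual_basis:
  "k \<in> SU2 \<Longrightarrow> coAd k (dual_basis v) = dual_basis (blinfun_apply (Ad k) v)"
  by (rule blinfun_eqI) (simp add: coAd_def matrix_inv_SU2 inner_Ad_left)

section \<open>The exponential and the derivative of the adjoint action\<close>

lemma mat_mult_nth: "(mat a ** (A :: 'a::comm_semiring_1^'n^'n)) $ i $ j = a * A $ i $ j"
  by (simp add: matrix_matrix_mult_def mat_def if_distrib[of "\<lambda>x. x * _"] sum.delta cong: if_cong)

text \<open>The square of A is scalar, so the powers of A alternate between scalars and multiples of
  A, and the even and odd parts of the series sum to cosh z and sinh z / z. Division by zero makes
  the latter 0 instead of 1 at z = 0; the assumption \<open>zero\<close> makes A vanish
  there.\<close>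

lemma mexp_of_square:
  assumes sq: "A ** A = mat (z\<^sup>2)" and zero: "z = 0 \<Longrightarrow> A = 0"
  shows "mexp A = mat (cosh z) + mat (sinh z / z) ** A"
proof -
  define a where "a n = (if even n then z ^ n else 0)" for n
  define b where "b n = (if even n then 0 else z ^ n / z)" for n
  have a_Suc: "a (Suc n) = b n * z\<^sup>2" for n
    by (cases "z = 0") (auto simp: a_def b_def power2_eq_square)
  have b_Suc: "b (Suc n) = a n" if "z \<noteq> 0" for n
    using that by (auto simp: a_def b_def)
  have pow: "((**) A ^^ n) (mat 1) = mat (a n) + mat (b n) ** A" for n
  proof (induction n)
    case 0
    then show ?case
      by (simp add: a_def b_def mat2_eq_iff mat_mult_nth)
  next
    case (Suc n)
    have "((**) A ^^ Suc n) (mat 1) = A ** (mat (a n) + mat (b n) ** A)"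
      using Suc by simp
    also have "\<dots> = mat (a n) ** A + mat (b n) ** (A ** A)"
      by (simp add: mat2_eq_iff mat_mult_nth) (simp add: matrix_matrix_mult_def mat_def sum_2 algebra_simps)
    also have "mat (b n) ** (A ** A) = mat (a (Suc n))"
      unfolding sq a_Suc by (simp add: mat2_eq_iff mat_mult_nth) (simp add: mat_def)
    also have "mat (a n) ** A = mat (b (Suc n)) ** A"
      using b_Suc zero by (cases "z = 0") (simp_all add: mat2_eq_iff mat_mult_nth)
    finally show ?case
      by (simp add: add.commute)
  qed
  have "linear (\<lambda>c::complex. mat c :: mat2)" "linear (\<lambda>c. mat c ** A)"
    by (auto intro!: linearI simp: mat2_eq_iff mat_mult_nth algebra_simps) (simp_all add: mat_def)
  then have bl: "bounded_linear (\<lambda>c::complex. mat c :: mat2)" "bounded_linear (\<lambda>c. mat c ** A)"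
    by (simp_all add: linear_conv_bounded_linear)
  have a: "(\<lambda>n. a n /\<^sub>R fact n) sums cosh z"
    using cosh_converges[of z] by (simp add: a_def if_distrib[of "\<lambda>x. x /\<^sub>R _"] cong: if_cong)
  have "(\<lambda>n. (if even n then 0 else z ^ n /\<^sub>R fact n) / z) sums (sinh z / z)"
    by (rule sums_divide[OF sinh_converges])
  also have "(\<lambda>n. (if even n then 0 else z ^ n /\<^sub>R fact n) / z) = (\<lambda>n. b n /\<^sub>R fact n)"
    by (auto simp: b_def fun_eq_iff scaleR_conv_of_real)
  finally have b: "(\<lambda>n. b n /\<^sub>R fact n) sums (sinh z / z)" .
  have "(\<lambda>n. mat (a n /\<^sub>R fact n) + mat (b n /\<^sub>R fact n) ** A)
      sums (mat (cosh z) + mat (sinh z / z) ** A)"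
    by (intro sums_add bounded_linear.sums[OF bl(1)] bounded_linear.sums[OF bl(2)] a b)
  also have "(\<lambda>n. mat (a n /\<^sub>R fact n) + mat (b n /\<^sub>R fact n) ** A)
      = (\<lambda>n. (1 / fact n) *\<^sub>R (((**) A ^^ n) (mat 1)))"
    unfolding pow linear_scale[OF \<open>linear (\<lambda>c. mat c ** A)\<close>]
    unfolding linear_scale[OF \<open>linear mat\<close>]
    by (simp add: scaleR_right_distrib divide_inverse)
  finally show ?thesis
    unfolding mexp_def by (rule sums_unique[symmetric])
qed

text \<open>Cayley-Hamilton at trace 0: the square is minus the determinant, which is |X|^2 / 8 in
  the given normalisation.\<close>

lemma Rep_su2_square: "Rep_su2 X ** Rep_su2 X = mat (- of_real ((norm X)\<^sup>2 / 8))"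
proof -
  show ?thesis
    unfolding mat2_eq_iff norm_su2_coords
    by (simp add: matrix_matrix_mult_def sum_2 mat_def Rep_su2_coords complex_eq_iff
        power2_eq_square field_simps sqrt_2_mult)
qed

text \<open>The coefficients are cos (m \<tau>) and sin (m \<tau>) / m. Later arguments need only
  the quadratic relation, which says that the determinant is 1, and the first-order behaviour at 0,
  so just these are exported.\<close>

lemma mexp_line:
  fixes X :: su2
  obtains c d :: "real \<Rightarrow> real" where
    "\<And>\<tau>. mexp (\<tau> *\<^sub>R Rep_su2 X) = mat (of_real (c \<tau>)) + mat (of_real (d \<tau>)) ** Rep_su2 X"
    "\<And>\<tau>. (c \<tau>)\<^sup>2 + (d \<tau>)\<^sup>2 * ((norm X)\<^sup>2 / 8) = 1"
    "c 0 = 1" "d 0 = 0"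
    "(c has_real_derivative 0) (at 0)" "(d has_real_derivative 1) (at 0)"
proof -
  define m where "m = norm X / (2 * sqrt 2)"
  define c where "c \<tau> = cos (m * \<tau>)" for \<tau>
  \<comment> \<open>The value at m = 0 is the limit of the quotient, so that d has derivative 1 at 0
    for X = 0 as well.\<close>
  define d where "d \<tau> = (if m = 0 then \<tau> else sin (m * \<tau>) / m)" for \<tau>
  have m2: "m\<^sup>2 = (norm X)\<^sup>2 / 8"
    by (simp add: m_def power2_eq_square field_simps sqrt_2_mult)
  have m0: "m = 0 \<longleftrightarrow> X = 0"
    by (simp add: m_def)
  have "mexp (\<tau> *\<^sub>R Rep_su2 X) = mat (of_real (c \<tau>)) + mat (of_real (d \<tau>)) ** Rep_su2 X" for \<tau>
  proof -
    define z where "z = \<i> * of_real (m * \<tau>)"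
    have "(\<tau> *\<^sub>R Rep_su2 X) ** (\<tau> *\<^sub>R Rep_su2 X) = \<tau>\<^sup>2 *\<^sub>R (Rep_su2 X ** Rep_su2 X)"
      by (simp add: mat2_eq_iff matrix_matrix_mult_def sum_2 power2_eq_square algebra_simps)
    also have "\<dots> = mat (z\<^sup>2)"
      unfolding Rep_su2_square m2[symmetric]
      by (simp add: z_def mat2_eq_iff mat_def power_mult_distrib scaleR_conv_of_real[where 'a = complex])
    finally have 1: "(\<tau> *\<^sub>R Rep_su2 X) ** (\<tau> *\<^sub>R Rep_su2 X) = mat (z\<^sup>2)" .
    have 2: "\<tau> *\<^sub>R Rep_su2 X = 0" if "z = 0"
      using that by (auto simp: z_def m0 zero_su2.rep_eq)
    have ch: "cosh z = of_real (c \<tau>)"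
      by (simp add: z_def c_def cosh_conv_cos mult.assoc[symmetric] flip: cos_of_real)
    have sh: "sinh z = \<i> * of_real (sin (m * \<tau>))"
      by (simp add: z_def sinh_conv_sin mult.assoc[symmetric] flip: sin_of_real)
    have "mexp (\<tau> *\<^sub>R Rep_su2 X) = mat (cosh z) + mat (sinh z / z) ** (\<tau> *\<^sub>R Rep_su2 X)"
      using 1 2 by (rule mexp_of_square)
    then show ?thesis
      unfolding ch sh
      by (cases "m = 0"; cases "\<tau> = 0")
        (simp_all add: m0 d_def zero_su2.rep_eq mat2_eq_iff mat_mult_nth z_def scaleR_conv_of_real[where 'a = complex])
  qed
  moreover have "(c \<tau>)\<^sup>2 + (d \<tau>)\<^sup>2 * ((norm X)\<^sup>2 / 8) = 1" for \<tau>
    unfolding m2[symmetric] by (cases "m = 0") (simp_all add: c_def d_def power_divide)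
  moreover have "c 0 = 1" "d 0 = 0"
    by (simp_all add: c_def d_def)
  moreover have "(c has_real_derivative 0) (at 0)"
    unfolding c_def by (auto intro!: derivative_eq_intros)
  moreover have "(d has_real_derivative 1) (at 0)"
    unfolding d_def by (cases "m = 0") (auto intro!: derivative_eq_intros)
  ultimately show ?thesis
    by (rule that)
qed

lemma mat2_in_SU2:
  fixes a b :: complex
  assumes "(cmod a)\<^sup>2 + (cmod b)\<^sup>2 = 1"
  shows "mat2 a b (- cnj b) (cnj a) \<in> SU2"
proof -
  have "a * cnj a + b * cnj b = 1"
    unfolding complex_norm_square[symmetric] of_real_add[symmetric] assms by simp
  then show ?thesis
    by (simp add: SU2_def mat2_eq_iff matrix_matrix_mult_def sum_2 mat_def det_2 algebra_simps)
qed

lemma mexp_su2_in_SU2: "mexp (\<tau> *\<^sub>R Rep_su2 X) \<in> SU2"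
proof -
  obtain c d where cd: "mexp (\<tau> *\<^sub>R Rep_su2 X) = mat (of_real (c \<tau>)) + mat (of_real (d \<tau>)) ** Rep_su2 X"
    "(c \<tau>)\<^sup>2 + (d \<tau>)\<^sup>2 * ((norm X)\<^sup>2 / 8) = 1"
    using mexp_line[of X] by metis
  define a where "a = of_real (c \<tau>) + of_real (d \<tau>) * Rep_su2 X $ 1 $ 1"
  define b where "b = of_real (d \<tau>) * Rep_su2 X $ 1 $ 2"
  have "mat (of_real (c \<tau>)) + mat (of_real (d \<tau>)) ** Rep_su2 X = mat2 a b (- cnj b) (cnj a)"
    unfolding mat2_eq_iff by (simp add: mat_mult_nth a_def b_def Rep_su2_coords complex_eq_iff) (simp add: mat_def)
  moreover have "(cmod a)\<^sup>2 + (cmod b)\<^sup>2 = 1"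
    using cd(2) unfolding norm_su2_coords cmod_power2
    by (simp add: a_def b_def Rep_su2_coords power2_eq_square field_simps sqrt_2_mult)
  ultimately show ?thesis
    using mat2_in_SU2 cd(1) by simp
qed

text \<open>Rodrigues' rotation formula, obtained by expanding (c + d X) V (c - d X).\<close>

lemma Ad_mexp_formula:
  assumes e: "e = mat (of_real c) + mat (of_real d) ** Rep_su2 X" and "e \<in> SU2"
  shows "blinfun_apply (Ad e) V = (c\<^sup>2 - d\<^sup>2 * ((norm X)\<^sup>2 / 8)) *\<^sub>R V
    + (c * d) *\<^sub>R lie_bracket X V + (d\<^sup>2 * inner X V / 4) *\<^sub>R X"
proof -
  have e_nth: "e $ 1 $ 1 = of_real c + of_real d * Rep_su2 X $ 1 $ 1" "e $ 1 $ 2 = of_real d * Rep_su2 X $ 1 $ 2"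
    "e $ 2 $ 1 = of_real d * Rep_su2 X $ 2 $ 1" "e $ 2 $ 2 = of_real c + of_real d * Rep_su2 X $ 2 $ 2"
    unfolding e by (simp_all add: mat_mult_nth) (simp_all add: mat_def)
  show ?thesis
    unfolding su2_eq_iff Rep_su2_Ad[OF assms(2)] plus_su2.rep_eq scaleR_su2.rep_eq Rep_su2_lie_bracket
      norm_su2_coords inner_su2_coords[of X V]
    by (simp add: matrix_matrix_mult_def sum_2 e_nth Rep_su2_coords complex_eq_iff
        power2_eq_square field_simps sqrt_2_mult)
qed

text \<open>The moving argument V + \<tau> W serves two purposes: W = 0 gives the generator of the
  coadjoint action, general W the derivative of \<open>mu_L\<close> along a flow line.\<close>

lemma has_vector_derivative_Ad_mexp:
  "((\<lambda>\<tau>. blinfun_apply (Ad (mexp (\<tau> *\<^sub>R Rep_su2 X))) (V + \<tau> *\<^sub>R W))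
    has_vector_derivative (lie_bracket X V + W)) (at 0)"
proof -
  obtain c d :: "real \<Rightarrow> real" where
    e: "\<And>\<tau>. mexp (\<tau> *\<^sub>R Rep_su2 X) = mat (of_real (c \<tau>)) + mat (of_real (d \<tau>)) ** Rep_su2 X"
    and [simp]: "c 0 = 1" "d 0 = 0"
    and cd: "(c has_real_derivative 0) (at 0)" "(d has_real_derivative 1) (at 0)"
    by (rule mexp_line[of X]) blast
  define N where "N = (norm X)\<^sup>2 / 8"
  have *: "blinfun_apply (Ad (mexp (\<tau> *\<^sub>R Rep_su2 X))) (V + \<tau> *\<^sub>R W) =
      ((c \<tau>)\<^sup>2 - (d \<tau>)\<^sup>2 * N) *\<^sub>R V + (c \<tau> * d \<tau>) *\<^sub>R lie_bracket X V + ((d \<tau>)\<^sup>2 * inner X V / 4) *\<^sub>R X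
      + \<tau> *\<^sub>R (((c \<tau>)\<^sup>2 - (d \<tau>)\<^sup>2 * N) *\<^sub>R W + (c \<tau> * d \<tau>) *\<^sub>R lie_bracket X W + ((d \<tau>)\<^sup>2 * inner X W / 4) *\<^sub>R X)"
    for \<tau>
    by (simp add: blinfun.bilinear_simps Ad_mexp_formula[OF e mexp_su2_in_SU2] N_def)
  \<comment> \<open>To first order c = 1 and d = \<tau>, so among the coefficients only c d, the one
    of the bracket, has a nonzero derivative.\<close>
  have 1: "((\<lambda>\<tau>. (c \<tau>)\<^sup>2 - (d \<tau>)\<^sup>2 * N) has_real_derivative 0) (at 0)"
    "((\<lambda>\<tau>. c \<tau> * d \<tau>) has_real_derivative 1) (at 0)"
    "((\<lambda>\<tau>. (d \<tau>)\<^sup>2 * a / 4) has_real_derivative 0) (at 0)" for a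
    by (auto intro!: derivative_eq_intros cd)
  show ?thesis
    unfolding *
    by (auto intro!: derivative_eq_intros 1[THEN DERIV_cong])
qed

lemma dual_basis_linear:
  "dual_basis (v + w) = dual_basis v + dual_basis w"
  "dual_basis (v - w) = dual_basis v - dual_basis w"
  "dual_basis (- v) = - dual_basis v"
  "dual_basis (r *\<^sub>R v) = r *\<^sub>R dual_basis v"
  by (auto intro!: blinfun_eqI simp: blinfun.bilinear_simps inner_left_distrib inner_diff_left)

lemma coad_generator_dual_basis: "coad_generator X (dual_basis v) = dual_basis (lie_bracket X v)"
proof -
  have "((\<lambda>\<tau>. dual_basis (blinfun_apply (Ad (mexp (\<tau> *\<^sub>R Rep_su2 X))) (v + \<tau> *\<^sub>R 0)))
    has_vector_derivative dual_basis (lie_bracket X v + 0)) (at 0)"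
    by (intro bounded_linear.has_vector_derivative[OF bounded_linear_dual_basis]
        has_vector_derivative_Ad_mexp)
  then show ?thesis
    by (simp add: coad_generator_def coAd_dual_basis mexp_su2_in_SU2 vector_derivative_at)
qed

lemma dir_deriv_mu_L:
  assumes "k \<in> SU2"
  shows "dir_deriv mu_L (k, dual_basis v) (X, \<eta>) =
    dual_basis (blinfun_apply (Ad k) (lie_bracket X v + phi \<eta>))"
proof -
  have "((\<lambda>\<tau>. dual_basis (blinfun_apply (Ad k) (blinfun_apply (Ad (mexp (\<tau> *\<^sub>R Rep_su2 X))) (v + \<tau> *\<^sub>R phi \<eta>))))
    has_vector_derivative dual_basis (blinfun_apply (Ad k) (lie_bracket X v + phi \<eta>))) (at 0)"
    by (intro bounded_linear.has_vector_derivative[OF bounded_linear_dual_basis]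
        bounded_linear.has_vector_derivative[OF blinfun.bounded_linear_right]
        has_vector_derivative_Ad_mexp)
  moreover have "mu_L (flow_line (k, dual_basis v) (X, \<eta>) \<tau>) =
      dual_basis (blinfun_apply (Ad k) (blinfun_apply (Ad (mexp (\<tau> *\<^sub>R Rep_su2 X))) (v + \<tau> *\<^sub>R phi \<eta>)))" for \<tau>
  proof -
    have "dual_basis v + \<tau> *\<^sub>R \<eta> = dual_basis (v + \<tau> *\<^sub>R phi \<eta>)"
      by (simp add: dual_basis_linear)
    then show ?thesis
      using assms by (simp add: mu_L_def flow_line_def coAd_dual_basis SU2_mult mexp_su2_in_SU2 Ad_mult)
  qed
  ultimately show ?thesis
    by (simp add: dir_deriv_def vector_derivative_at)
qed

section \<open>The tautological form in the left trivialization\<close>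

lemma left_triv_left [simp]: "k \<in> SU2 \<Longrightarrow> left_triv k (k ** Rep_su2 X) = X"
  by (simp add: left_triv_def matrix_inv_SU2 matrix_mul_assoc) (simp add: SU2_def Rep_su2_inverse)

lemma left_triv_right: "k \<in> SU2 \<Longrightarrow> left_triv k (Rep_su2 X ** k) = blinfun_apply (Ad (ctranspose k)) X"
  by (simp add: left_triv_def matrix_inv_SU2 SU2_ctranspose Ad_apply matrix_mul_assoc)

lemma theta_taut_apply: "k \<in> SU2 \<Longrightarrow> theta_taut (k, \<xi>) (X, \<eta>) = blinfun_apply \<xi> X"
  by (simp add: theta_taut_def)

text \<open>On left-constant fields the form depends on the momentum alone, and the momentum is
  affine along a flow line.\<close>

lemma dir_deriv_theta_taut:
  assumes "k \<in> SU2"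
  shows "dir_deriv (\<lambda>q. theta_taut q (Y, \<zeta>)) (k, \<xi>) (X, \<eta>) = blinfun_apply \<eta> Y"
proof -
  have "theta_taut (flow_line (k, \<xi>) (X, \<eta>) \<tau>) (Y, \<zeta>) = blinfun_apply \<xi> Y + \<tau> *\<^sub>R blinfun_apply \<eta> Y" for \<tau>
    using assms by (simp add: flow_line_def theta_taut_apply SU2_mult mexp_su2_in_SU2 blinfun.bilinear_simps)
  moreover have "((\<lambda>\<tau>. blinfun_apply \<xi> Y + \<tau> *\<^sub>R blinfun_apply \<eta> Y) has_vector_derivative blinfun_apply \<eta> Y) (at 0)"
    by (auto intro!: derivative_eq_intros)
  ultimately show ?thesis
    by (simp add: dir_deriv_def vector_derivative_at)
qed

section \<open>The map E\<close>

text \<open>The Hermitian matrix 2 s i v has the eigenvalues plus and minus (s / sqrt 2) |v|, whence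
  the argument of cosh.\<close>

definition cosh_rad :: "real \<Rightarrow> su2 \<Rightarrow> real" where
  "cosh_rad s v = cosh (s / sqrt 2 * norm v)"

(* At v = 0 this is 0 and not the limit s / sqrt 2; it only ever multiplies a component of v there. *)
definition sinh_rad :: "real \<Rightarrow> su2 \<Rightarrow> real" where
  "sinh_rad s v = sinh (s / sqrt 2 * norm v) / norm v"

lemma cosh_sinh_rad: "(cosh_rad s v)\<^sup>2 = (sinh_rad s v)\<^sup>2 * (norm v)\<^sup>2 + 1"
  by (cases "v = 0") (simp_all add: cosh_rad_def sinh_rad_def power_divide cosh_square_eq)

text \<open>Cauchy-Schwarz together with cosh^2 = sinh^2 + 1. For e = \<open>t_su\<close> it says
  that the diagonal entries of the positive definite matrix exp (2 s i v) are positive, so that E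
  can contain their square roots.\<close>

lemma sinh_rad_less_cosh_rad:
  assumes "norm e = 1"
  shows "\<bar>sinh_rad s v * inner v e\<bar> < cosh_rad s v"
proof (rule power2_less_imp_less)
  have "(inner v e)\<^sup>2 \<le> (norm v)\<^sup>2"
    using Cauchy_Schwarz_ineq2[of v e] assms by (simp add: abs_le_square_iff[symmetric])
  then have "(sinh_rad s v)\<^sup>2 * (inner v e)\<^sup>2 \<le> (sinh_rad s v)\<^sup>2 * (norm v)\<^sup>2"
    by (rule mult_left_mono) simp
  then show "\<bar>sinh_rad s v * inner v e\<bar>\<^sup>2 < (cosh_rad s v)\<^sup>2"
    by (simp add: cosh_sinh_rad power_mult_distrib)
  show "0 \<le> cosh_rad s v"
    by (simp add: cosh_rad_def)
qed

lemma norm_t_su: "norm t_su = 1"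
  by (simp add: norm_eq_sqrt_inner su2_basis_inner)

lemma rad_denominators_pos:
  "cosh_rad s v - sinh_rad s v * inner v t_su > 0" "cosh_rad s v + sinh_rad s v * inner v t_su > 0"
  using sinh_rad_less_cosh_rad[OF norm_t_su, of s v] by linarith+

(* The upper right entry of exp (2 s i v). *)
definition corner :: "real \<Rightarrow> su2 \<Rightarrow> complex" where
  "corner s v = of_real (sinh_rad s v) * (\<i> * of_real (inner v x_su) - of_real (inner v y_su))"

text \<open>This is the determinant condition for exp (2 s i v): diagonal product minus squared
  modulus of the corner equals 1.\<close>

lemma cmod_corner:
  "(cmod (corner s v))\<^sup>2 + 1 =
    (cosh_rad s v - sinh_rad s v * inner v t_su) * (cosh_rad s v + sinh_rad s v * inner v t_su)"
proof -
  have "(cmod (corner s v))\<^sup>2 + 1 = (sinh_rad s v)\<^sup>2 * ((inner v x_su)\<^sup>2 + (inner v y_su)\<^sup>2) + 1"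
    unfolding corner_def norm_mult power_mult_distrib by (simp add: cmod_power2 add.commute)
  also have "\<dots> = (cosh_rad s v)\<^sup>2 - (sinh_rad s v * inner v t_su)\<^sup>2"
    unfolding cosh_sinh_rad norm_su2_coords by (simp add: power_mult_distrib algebra_simps)
  finally show ?thesis
    by (simp add: power2_eq_square algebra_simps)
qed

lemma mat_mult_mat_mult: "(mat a ** A) ** (mat b ** B) = mat (a * b) ** (A ** B)"
  for A B :: "'a::comm_semiring_1^'n^'n"
  unfolding vec_eq_iff mat_mult_nth
  by (simp add: matrix_matrix_mult_def[of "mat a ** A"] matrix_matrix_mult_def[of A] mat_mult_nth
      sum_distrib_left mult_ac)

lemma cosh_sinh_of_real:
  "cosh (of_real x :: complex) = of_real (cosh x)" "sinh (of_real x :: complex) = of_real (sinh x)"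
  by (simp_all add: cosh_def sinh_def scaleR_conv_of_real flip: exp_of_real)

lemma mexp_hermitian:
  assumes "s > 0"
  shows "mexp (mat (2 * of_real s * \<i>) ** Rep_su2 v) =
    mat2 (of_real (cosh_rad s v - sinh_rad s v * inner v t_su)) (corner s v)
      (cnj (corner s v)) (of_real (cosh_rad s v + sinh_rad s v * inner v t_su))"
proof -
  let ?A = "mat (2 * of_real s * \<i>) ** Rep_su2 v :: mat2"
  define z :: complex where "z = of_real (s / sqrt 2 * norm v)"
  have "?A ** ?A = mat ((2 * of_real s * \<i>)\<^sup>2) ** (Rep_su2 v ** Rep_su2 v)"
    by (simp only: mat_mult_mat_mult power2_eq_square)
  also have "\<dots> = mat (z\<^sup>2)"
    unfolding Rep_su2_square
    by (simp add: z_def mat2_eq_iff mat_mult_nth)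
      (simp add: mat_def power_mult_distrib power_divide flip: of_real_power)
  finally have 1: "?A ** ?A = mat (z\<^sup>2)" .
  have 2: "?A = 0" if "z = 0"
    using that assms by (simp add: z_def zero_su2.rep_eq)
  have "mexp ?A = mat (cosh z) + mat (sinh z / z) ** ?A"
    using 1 2 by (rule mexp_of_square)
  moreover have "cosh z = of_real (cosh_rad s v)"
    unfolding z_def cosh_rad_def by (rule cosh_sinh_of_real)
  moreover have "sinh z / z = of_real (sinh_rad s v * sqrt 2 / s)"
    unfolding z_def cosh_sinh_of_real by (simp add: sinh_rad_def)
  ultimately show ?thesis
    using assms
    by (simp add: mat2_eq_iff mat_mult_nth)
      (simp add: mat_def Rep_su2_coords complex_eq_iff corner_def field_simps sqrt_2_mult)
qed

section \<open>E as a Cholesky factor, for both conventions\<close>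

lemma AN_cases:
  assumes "b \<in> AN"
  obtains a z where "b = mat2 (of_real a) z 0 (of_real (1 / a))" "a > 0"
proof -
  define a where "a = Re (b $ 1 $ 1)"
  have b: "b $ 2 $ 1 = 0" "b $ 1 $ 1 * b $ 2 $ 2 = 1" "b $ 1 $ 1 = of_real a" "a > 0"
    using assms by (auto simp: AN_def det_2 a_def complex_eq_iff)
  then have "b $ 2 $ 2 = of_real (1 / a)"
    by (simp add: field_simps)
  with b have "b = mat2 (of_real a) (b $ 1 $ 2) 0 (of_real (1 / a))"
    by (simp add: mat2_eq_iff)
  then show ?thesis
    using that b(4) by blast
qed

lemma inj_on_AN_star:
  "inj_on (\<lambda>b. ctranspose b ** b) AN" "inj_on (\<lambda>b. b ** ctranspose b) AN"
proof -
  show "inj_on (\<lambda>b. ctranspose b ** b) AN"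
  proof (rule inj_onI)
    fix b b' assume "b \<in> AN" "b' \<in> AN" and eq: "ctranspose b ** b = ctranspose b' ** b'"
    then obtain a z a' z' where b: "b = mat2 (of_real a) z 0 (of_real (1 / a))" "a > 0"
      "b' = mat2 (of_real a') z' 0 (of_real (1 / a'))" "a' > 0"
      by (metis AN_cases)
    have "complex_of_real (a * a) = of_real (a' * a')" and z: "of_real a * z = of_real a' * z'"
      using eq by (simp_all add: b mat2_eq_iff matrix_matrix_mult_def sum_2)
    then have "a\<^sup>2 = a'\<^sup>2"
      unfolding of_real_eq_iff by (simp add: power2_eq_square)
    then have "a = a'"
      using b(2,4) by (simp add: power2_eq_iff_nonneg)
    then show "b = b'"
      using z b by simp
  qed
  show "inj_on (\<lambda>b. b ** ctranspose b) AN"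
  proof (rule inj_onI)
    fix b b' assume "b \<in> AN" "b' \<in> AN" and eq: "b ** ctranspose b = b' ** ctranspose b'"
    then obtain a z a' z' where b: "b = mat2 (of_real a) z 0 (of_real (1 / a))" "a > 0"
      "b' = mat2 (of_real a') z' 0 (of_real (1 / a'))" "a' > 0"
      by (metis AN_cases)
    have "complex_of_real (1 / a * (1 / a)) = of_real (1 / a' * (1 / a'))" and z: "z * of_real (1 / a) = z' * of_real (1 / a')"
      using eq by (simp_all add: b mat2_eq_iff matrix_matrix_mult_def sum_2)
    then have "(1 / a)\<^sup>2 = (1 / a')\<^sup>2"
      unfolding of_real_eq_iff by (simp add: power2_eq_square)
    then have "1 / a = 1 / a'"
      using b(2,4) by (subst (asm) power2_eq_iff_nonneg) simp_all
    then show "b = b'"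
      using z b by simp
  qed
qed

lemma E_map_star_left:
  assumes "s > 0"
  shows "E_map (\<lambda>b. ctranspose b ** b) s \<zeta> =
    (let v = phi \<zeta>; a = complex_of_real (sqrt (cosh_rad s v - sinh_rad s v * inner v t_su))
     in mat2 a (corner s v / a) 0 (1 / a))"
proof -
  define v where "v = phi \<zeta>"
  define D where "D = cosh_rad s v - sinh_rad s v * inner v t_su"
  define a where "a = sqrt D"
  have a: "a > 0" "a * a = D" "complex_of_real a * of_real a = of_real D"
    using rad_denominators_pos(1)[of s v] by (simp_all add: a_def D_def flip: of_real_mult)
  let ?b = "mat2 a (corner s v / a) 0 (1 / a)"
  have "?b \<in> AN"
    using a(1) by (simp add: AN_def det_2 forall_2)
  moreover have "ctranspose ?b ** ?b = mexp (mat (2 * of_real s * \<i>) ** Rep_su2 v)"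
  proof -
    \<comment> \<open>The first row and column match by construction of ?b; the lower right entry
      (|corner|^2 + 1) / D is correct because the exponential has determinant 1.\<close>
    have "cnj (corner s v) * corner s v + 1 = of_real (D * (cosh_rad s v + sinh_rad s v * inner v t_su))"
      unfolding D_def cmod_corner[symmetric] by (simp add: complex_norm_square[symmetric] mult.commute[of "cnj _"])
    moreover have "D \<noteq> 0" using a by auto
    ultimately have "(cnj (corner s v) * corner s v + 1) / of_real D = of_real (cosh_rad s v + sinh_rad s v * inner v t_su)"
      by simp
    then show ?thesis
      unfolding mexp_hermitian[OF assms] D_def[symmetric]
      using a(1) by (simp add: mat2_eq_iff matrix_matrix_mult_def sum_2 a(3) add_divide_distrib)
  qed
  ultimately have "E_map (\<lambda>b. ctranspose b ** b) s \<zeta> = ?b"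
    unfolding E_map_def v_def[symmetric] by (intro inv_into_f_eq inj_on_AN_star)
  then show ?thesis
    by (simp add: Let_def a_def D_def v_def)
qed

text \<open>For b b^* the factor is read off from the lower right entry of the exponential, which
  accounts for the opposite sign in front of \<open>sinh_rad\<close>.\<close>

lemma E_map_star_right:
  assumes "s > 0"
  shows "E_map (\<lambda>b. b ** ctranspose b) s \<zeta> =
    (let v = phi \<zeta>; a = complex_of_real (sqrt (cosh_rad s v + sinh_rad s v * inner v t_su))
     in mat2 (1 / a) (corner s v / a) 0 a)"
proof -
  define v where "v = phi \<zeta>"
  define D where "D = cosh_rad s v + sinh_rad s v * inner v t_su"
  define a where "a = sqrt D"
  have a: "a > 0" "a * a = D" "complex_of_real a * of_real a = of_real D"
    using rad_denominators_pos(2)[of s v] by (simp_all add: a_def D_def flip: of_real_mult)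
  let ?b = "mat2 (1 / a) (corner s v / a) 0 a"
  have "?b \<in> AN"
    using a(1) by (simp add: AN_def det_2 forall_2)
  moreover have "?b ** ctranspose ?b = mexp (mat (2 * of_real s * \<i>) ** Rep_su2 v)"
  proof -
    have "corner s v * cnj (corner s v) + 1 = of_real (D * (cosh_rad s v - sinh_rad s v * inner v t_su))"
      using cmod_corner[of s v] unfolding D_def mult.commute[of "_ + _" "_ - _"]
      by (simp add: complex_norm_square[symmetric] flip: of_real_eq_iff[where 'a = complex])
    moreover have "D \<noteq> 0" using a by auto
    ultimately have "(corner s v * cnj (corner s v) + 1) / of_real D = of_real (cosh_rad s v - sinh_rad s v * inner v t_su)"
      by simp
    then show ?thesis
      unfolding mexp_hermitian[OF assms] D_def[symmetric]
      using a(1) by (simp add: mat2_eq_iff matrix_matrix_mult_def sum_2 a(3) add_divide_distrib add.commute)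
  qed
  ultimately have "E_map (\<lambda>b. b ** ctranspose b) s \<zeta> = ?b"
    unfolding E_map_def v_def[symmetric] by (intro inv_into_f_eq inj_on_AN_star)
  then show ?thesis
    by (simp add: Let_def a_def D_def v_def)
qed

section \<open>Derivatives of the radial functions away from 0\<close>

lemma has_derivative_norm_inner:
  fixes v :: "'a::real_inner"
  shows "v \<noteq> 0 \<Longrightarrow> (norm has_derivative (\<lambda>w. inner v w / norm v)) (at v)"
  by (rule has_derivative_eq_rhs[OF has_derivative_norm])
    (simp_all add: fun_eq_iff sgn_div_norm inner_commute divide_inverse mult.commute)

lemma has_derivative_cosh_rad:
  assumes "v \<noteq> 0"
  shows "(cosh_rad s has_derivative (\<lambda>w. s / sqrt 2 * sinh_rad s v * inner v w)) (at v)"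
proof -
  have "((\<lambda>x. s / sqrt 2 * norm x) has_derivative (\<lambda>w. s / sqrt 2 * inner v w / norm v)) (at v)"
    by (rule has_derivative_eq_rhs, (rule derivative_intros has_derivative_norm_inner assms)+) auto
  from DERIV_compose_FDERIV[OF has_field_derivative_cosh[OF DERIV_ident] this]
  show ?thesis
    by (simp add: cosh_rad_def[abs_def] sinh_rad_def mult_ac)
qed

lemma has_derivative_sinh_rad:
  assumes "v \<noteq> 0"
  shows "(sinh_rad s has_derivative
    (\<lambda>w. (s / sqrt 2 * cosh_rad s v - sinh_rad s v) / (norm v)\<^sup>2 * inner v w)) (at v)"
proof -
  have "((\<lambda>x. s / sqrt 2 * norm x) has_derivative (\<lambda>w. s / sqrt 2 * inner v w / norm v)) (at v)"
    by (rule has_derivative_eq_rhs, (rule derivative_intros has_derivative_norm_inner assms)+) auto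
  from has_derivative_divide'[OF DERIV_compose_FDERIV[OF has_field_derivative_sinh[OF DERIV_ident] this] has_derivative_norm_inner[OF assms]]
  show ?thesis
    unfolding sinh_rad_def[abs_def] using assms
    by (auto elim!: has_derivative_eq_rhs simp: cosh_rad_def fun_eq_iff field_simps power2_eq_square)
qed

lemma has_derivative_mat2:
  assumes "(a has_derivative a') (at x within A)" "(b has_derivative b') (at x within A)"
    "(c has_derivative c') (at x within A)" "(d has_derivative d') (at x within A)"
  shows "((\<lambda>x. mat2 (a x) (b x) (c x) (d x)) has_derivative (\<lambda>x. mat2 (a' x) (b' x) (c' x) (d' x))) (at x within A)"
proof -
  let ?m = "\<lambda>(a, b, c, d). mat2 a b c d"
  have "linear ?m"
    by (auto intro!: linearI simp: mat2_eq_iff)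
  then have "bounded_linear ?m"
    by (simp add: linear_conv_bounded_linear)
  from bounded_linear.has_derivative[OF this has_derivative_Pair[OF assms(1) has_derivative_Pair[OF assms(2)
      has_derivative_Pair[OF assms(3,4)]]]]
  show ?thesis
    by simp
qed

section \<open>The pairing with the Maurer-Cartan form\<close>

text \<open>The derivative of \<open>sinh_rad s\<close> at v along w, for v nonzero; the two
  definitions after it have the same role for \<open>cosh_rad\<close> and
  \<open>corner\<close>.\<close>

definition sinh_rad' :: "real \<Rightarrow> su2 \<Rightarrow> su2 \<Rightarrow> real" where
  "sinh_rad' s v w = (s / sqrt 2 * cosh_rad s v - sinh_rad s v) / (norm v)\<^sup>2 * inner v w"

definition cosh_rad' :: "real \<Rightarrow> su2 \<Rightarrow> su2 \<Rightarrow> real" where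
  "cosh_rad' s v w = s / sqrt 2 * sinh_rad s v * inner v w"

definition corner' :: "real \<Rightarrow> su2 \<Rightarrow> su2 \<Rightarrow> complex" where
  "corner' s v w = of_real (sinh_rad' s v w) * (\<i> * of_real (inner v x_su) - of_real (inner v y_su))
    + of_real (sinh_rad s v) * (\<i> * of_real (inner w x_su) - of_real (inner w y_su))"

lemma has_derivative_corner:
  assumes "v \<noteq> 0"
  shows "(corner s has_derivative corner' s v) (at v)"
  unfolding corner_def corner'_def[abs_def]
  by (rule has_derivative_eq_rhs,
      (rule derivative_intros has_derivative_of_real has_derivative_sinh_rad[OF assms, folded sinh_rad'_def])+)
    (simp add: fun_eq_iff algebra_simps)

lemma matrix_inv_upper:
  fixes a z :: complex
  assumes "a \<noteq> 0"
  shows "matrix_inv (mat2 a z 0 (1 / a)) = mat2 (1 / a) (- z) 0 a"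
  by (rule matrix_inv_eqI) (use assms in \<open>simp_all add: mat2_eq_iff matrix_matrix_mult_def sum_2 mat_def\<close>)

text \<open>The second factors keep the exact shape that the quotient rule delivers, including
  \<open>0 * a - 1 * a'\<close> for the constant numerator, so that the equations rewrite the
  derivative of E directly.\<close>

lemma upper_log_derivative:
  fixes a a' z z' :: complex
  assumes "a \<noteq> 0"
  shows "matrix_inv (mat2 a (z / a) 0 (1 / a)) **
      mat2 a' ((z' * a - z * a') / (a * a)) 0 ((0 * a - 1 * a') / (a * a)) =
    mat2 (a' / a) (z' / (a * a)) 0 (- (a' / a))"
    and "matrix_inv (mat2 (1 / a) (z / a) 0 a) **
      mat2 ((0 * a - 1 * a') / (a * a)) ((z' * a - z * a') / (a * a)) 0 a' =
    mat2 (- (a' / a)) (z' - 2 * z * a' / a) 0 (a' / a)"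
proof -
  have inv: "matrix_inv (mat2 (1 / a) (z / a) 0 a) = mat2 a (- (z / a)) 0 (1 / a)"
    using matrix_inv_upper[of "1 / a" "z / a"] assms by simp
  show "matrix_inv (mat2 a (z / a) 0 (1 / a)) **
      mat2 a' ((z' * a - z * a') / (a * a)) 0 ((0 * a - 1 * a') / (a * a)) =
    mat2 (a' / a) (z' / (a * a)) 0 (- (a' / a))"
    unfolding matrix_inv_upper[OF assms] mat2_eq_iff using assms
    by (simp add: matrix_matrix_mult_def sum_2 field_simps)
  show "matrix_inv (mat2 (1 / a) (z / a) 0 a) **
      mat2 ((0 * a - 1 * a') / (a * a)) ((z' * a - z * a') / (a * a)) 0 a' =
    mat2 (- (a' / a)) (z' - 2 * z * a' / a) 0 (a' / a)"
    unfolding inv mat2_eq_iff using assms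
    by (simp add: matrix_matrix_mult_def sum_2 field_simps)
qed

text \<open>Traceless upper triangular matrices with real diagonal form the Lie algebra of AN. For
  nonzero s the pairing puts it in duality with su(2): the diagonal sees t, the corner sees x and
  y.\<close>

lemma pairing_upper:
  "pairing s (mat2 (of_real p) z 0 (- of_real p)) (Rep_su2 X) =
    - (sqrt 2 / s) * (2 * p * inner X t_su + Re z * inner X y_su - Im z * inner X x_su)"
  by (cases "s = 0") (simp_all add: pairing_def trace_mult_mat2 Rep_su2_coords field_simps sqrt_2_mult)

lemma frechet_derivative_phi:
  assumes "(G has_derivative G') (at v)"
  shows "frechet_derivative (\<lambda>\<zeta>. G (phi \<zeta>)) (at (dual_basis v)) \<eta> = G' (phi \<eta>)"
proof -
  have "((\<lambda>\<zeta>. G (phi \<zeta>)) has_derivative (\<lambda>\<eta>. G' (phi \<eta>))) (at (dual_basis v))"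
    by (rule has_derivative_compose[OF bounded_linear_imp_has_derivative[OF bounded_linear_phi], of G]) (use assms in simp)
  from frechet_derivative_at[OF this, symmetric] show ?thesis
    by simp
qed

lemma has_derivative_sqrt:
  assumes "(D has_derivative D') (at v)" "D v > 0"
  shows "((\<lambda>x. sqrt (D x)) has_derivative (\<lambda>w. D' w / (2 * sqrt (D v)))) (at v)"
  by (rule has_derivative_eq_rhs[OF DERIV_compose_FDERIV[OF DERIV_real_sqrt[OF assms(2)] assms(1)]])
    (simp add: fun_eq_iff field_simps)

text \<open>With a the square root of D, the product b^{-1} db contains a only through a^2 = D and
  a' / a = D' / (2 D), so the square root disappears.\<close>

lemma maurer_cartan_star_left:
  fixes w :: su2
  assumes s: "s > 0" and v: "v \<noteq> 0"
  defines "D \<equiv> cosh_rad s v - sinh_rad s v * inner v t_su"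
  defines "D' \<equiv> cosh_rad' s v w - sinh_rad' s v w * inner v t_su - sinh_rad s v * inner w t_su"
  shows "maurer_cartan_L (E_map (\<lambda>b. ctranspose b ** b) s (dual_basis v))
      (frechet_derivative (E_map (\<lambda>b. ctranspose b ** b) s) (at (dual_basis v)) (dual_basis w)) =
    mat2 (of_real (D' / (2 * D))) (corner' s v w / of_real D) 0 (- of_real (D' / (2 * D)))"
proof -
  define a where "a u = sqrt (cosh_rad s u - sinh_rad s u * inner u t_su)" for u
  define a' where "a' w = (cosh_rad' s v w - sinh_rad' s v w * inner v t_su - sinh_rad s v * inner w t_su) / (2 * a v)" for w
  define G where "G u = mat2 (of_real (a u)) (corner s u / of_real (a u)) 0 (1 / of_real (a u))" for u
  have E: "E_map (\<lambda>b. ctranspose b ** b) s = (\<lambda>\<zeta>. G (phi \<zeta>))"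
    by (simp add: fun_eq_iff E_map_star_left[OF s] Let_def G_def a_def)
  have D: "D > 0"
    unfolding D_def by (rule rad_denominators_pos)
  have av: "a v > 0" "a v * a v = D"
    using D by (simp_all add: a_def D_def)
  have a: "(a has_derivative a') (at v)"
    unfolding a_def a'_def[abs_def]
    by (rule has_derivative_eq_rhs, rule has_derivative_sqrt,
        (rule derivative_intros has_derivative_sinh_rad[OF v, folded sinh_rad'_def]
          has_derivative_cosh_rad[OF v, folded cosh_rad'_def])+)
      (use D in \<open>simp_all add: D_def fun_eq_iff algebra_simps\<close>)
  then have ca: "((\<lambda>u. complex_of_real (a u)) has_derivative (\<lambda>w. of_real (a' w))) (at v)"
    by (rule has_derivative_of_real)
  have a0: "complex_of_real (a v) \<noteq> 0"
    using av by simp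
  note quot = has_derivative_divide'[OF has_derivative_corner[OF v] ca a0]
  note inv = has_derivative_divide'[OF has_derivative_const ca a0, of 1]
  have G: "(G has_derivative (\<lambda>w. mat2 (of_real (a' w)) ((corner' s v w * of_real (a v) - corner s v * of_real (a' w)) / (of_real (a v) * of_real (a v))) 0 ((0 * of_real (a v) - 1 * of_real (a' w)) / (of_real (a v) * of_real (a v))))) (at v)"
    unfolding G_def by (rule has_derivative_mat2[OF ca quot has_derivative_const inv])
  have "D' = 2 * a v * a' w"
    using av by (simp add: a'_def D'_def)
  then have "D' / (2 * D) = a' w / a v"
    using av(1) by (simp flip: av(2))
  then show ?thesis
    unfolding E frechet_derivative_phi[OF G] phi_dual_basis maurer_cartan_L_def
    unfolding G_def upper_log_derivative(1)[OF a0] by (simp flip: av(2))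
qed

text \<open>In contrast to the other convention, the corner retains a term with
  \<open>corner\<close> undifferentiated. This term is what makes the convention incompatible with
  an alternating \<Omega>.\<close>

lemma maurer_cartan_star_right:
  fixes w :: su2
  assumes s: "s > 0" and v: "v \<noteq> 0"
  defines "D \<equiv> cosh_rad s v + sinh_rad s v * inner v t_su"
  defines "D' \<equiv> cosh_rad' s v w + sinh_rad' s v w * inner v t_su + sinh_rad s v * inner w t_su"
  shows "maurer_cartan_L (E_map (\<lambda>b. b ** ctranspose b) s (dual_basis v))
      (frechet_derivative (E_map (\<lambda>b. b ** ctranspose b) s) (at (dual_basis v)) (dual_basis w)) =
    mat2 (of_real (- D' / (2 * D))) (corner' s v w - corner s v * of_real (D' / D)) 0 (- of_real (- D' / (2 * D)))"
proof -
  define a where "a u = sqrt (cosh_rad s u + sinh_rad s u * inner u t_su)" for u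
  define a' where "a' w = (cosh_rad' s v w + sinh_rad' s v w * inner v t_su + sinh_rad s v * inner w t_su) / (2 * a v)" for w
  define G where "G u = mat2 (1 / of_real (a u)) (corner s u / of_real (a u)) 0 (of_real (a u))" for u
  have E: "E_map (\<lambda>b. b ** ctranspose b) s = (\<lambda>\<zeta>. G (phi \<zeta>))"
    by (simp add: fun_eq_iff E_map_star_right[OF s] Let_def G_def a_def)
  have D: "D > 0"
    unfolding D_def by (rule rad_denominators_pos)
  have av: "a v > 0" "a v * a v = D"
    using D by (simp_all add: a_def D_def)
  have a: "(a has_derivative a') (at v)"
    unfolding a_def a'_def[abs_def]
    by (rule has_derivative_eq_rhs, rule has_derivative_sqrt,
        (rule derivative_intros has_derivative_sinh_rad[OF v, folded sinh_rad'_def]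
          has_derivative_cosh_rad[OF v, folded cosh_rad'_def])+)
      (use D in \<open>simp_all add: D_def fun_eq_iff algebra_simps\<close>)
  then have ca: "((\<lambda>u. complex_of_real (a u)) has_derivative (\<lambda>w. of_real (a' w))) (at v)"
    by (rule has_derivative_of_real)
  have a0: "complex_of_real (a v) \<noteq> 0"
    using av by simp
  note quot = has_derivative_divide'[OF has_derivative_corner[OF v] ca a0]
  note inv = has_derivative_divide'[OF has_derivative_const ca a0, of 1]
  have G: "(G has_derivative (\<lambda>w. mat2 ((0 * of_real (a v) - 1 * of_real (a' w)) / (of_real (a v) * of_real (a v))) ((corner' s v w * of_real (a v) - corner s v * of_real (a' w)) / (of_real (a v) * of_real (a v))) 0 (of_real (a' w)))) (at v)"
    unfolding G_def by (rule has_derivative_mat2[OF inv quot has_derivative_const ca])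
  have "D' = 2 * a v * a' w"
    using av by (simp add: a'_def D'_def)
  then have eqs: "D' / (2 * D) = a' w / a v" "D' / D = 2 * (a' w / a v)"
    using av(1) by (simp_all flip: av(2))
  show ?thesis
    unfolding E frechet_derivative_phi[OF G] phi_dual_basis maurer_cartan_L_def
    unfolding G_def upper_log_derivative(2)[OF a0] minus_divide_left[symmetric] eqs by (simp add: mult_ac)
qed

lemma deforming_form_dual_basis:
  "deforming_form f s \<Omega> \<Longrightarrow>
    blinfun_apply (blinfun_apply (\<Omega> (dual_basis v)) (dual_basis (lie_bracket X v))) (dual_basis w) =
    pairing s (maurer_cartan_L (E_map f s (dual_basis v))
      (frechet_derivative (E_map f s) (at (dual_basis v)) (dual_basis w))) (Rep_su2 X) - inner w X"
proof -
  assume "deforming_form f s \<Omega>"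
  moreover have "frechet_derivative (\<lambda>\<zeta>. blinfun_apply \<zeta> X) (at (dual_basis v)) (dual_basis w) = inner w X"
    by (simp add: frechet_derivative_at[OF bounded_linear_imp_has_derivative[OF blinfun.bounded_linear_left], symmetric])
  ultimately show ?thesis
    unfolding deforming_form_def coad_generator_dual_basis[symmetric] by simp
qed

lemma deforming_form_alternating:
  "deforming_form f s \<Omega> \<Longrightarrow> blinfun_apply (blinfun_apply (\<Omega> \<xi>) u) u = 0"
  by (simp add: deforming_form_def closed_2form_def)

(* At v = x + y and along w = [x, v] the left-hand side \<Omega>(w, w) vanishes, but the pairing does not. *)
lemma not_deforming_form_star_right:
  assumes "s > 0"
  shows "\<not> deforming_form (\<lambda>b. b ** ctranspose b) s \<Omega>"
proof
  assume \<Omega>: "deforming_form (\<lambda>b. b ** ctranspose b) s \<Omega>"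
  define v where "v = x_su + y_su"
  define w where "w = lie_bracket x_su v"
  have v: "inner v x_su = 1" "inner v y_su = 1" "inner v t_su = 0"
    by (simp_all add: v_def inner_left_distrib su2_basis_inner)
  then have w: "inner w x_su = 0" "inner w y_su = 0" "inner w t_su = 1 / sqrt 2"
    by (simp_all add: w_def lie_bracket_coords su2_basis_inner)
  have "v \<noteq> 0"
    using v by force
  have vw: "inner v w = 0"
    by (subst inner_su2_coords) (simp add: v w)
  have "sinh_rad s v \<noteq> 0" "cosh_rad s v \<noteq> 0"
    using \<open>v \<noteq> 0\<close> assms by (simp_all add: sinh_rad_def cosh_rad_def)
  moreover have "pairing s (maurer_cartan_L (E_map (\<lambda>b. b ** ctranspose b) s (dual_basis v))
      (frechet_derivative (E_map (\<lambda>b. b ** ctranspose b) s) (at (dual_basis v)) (dual_basis w))) (Rep_su2 x_su)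
      - inner w x_su = 0"
    using deforming_form_dual_basis[OF \<Omega>, of v x_su w] deforming_form_alternating[OF \<Omega>]
    by (simp add: w_def)
  ultimately show False
    unfolding maurer_cartan_star_right[OF assms \<open>v \<noteq> 0\<close>] pairing_upper using assms
    by (simp add: v w vw su2_basis_inner sinh_rad'_def cosh_rad'_def corner'_def corner_def)
qed

text \<open>The diagonal entry supplies the t components of <w, X> and <v, X>, the corner the x and
  y components, and together they form invariant inner products. The vector t survives only in the
  denominator and in the term that comes from the derivative of cosh.\<close>

lemma pairing_maurer_cartan_star_left:
  assumes s: "s > 0" and v: "v \<noteq> 0"
  shows "pairing s (maurer_cartan_L (E_map (\<lambda>b. ctranspose b ** b) s (dual_basis v))
      (frechet_derivative (E_map (\<lambda>b. ctranspose b ** b) s) (at (dual_basis v)) (dual_basis w))) (Rep_su2 X) =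
    sqrt 2 / (s * (cosh_rad s v - sinh_rad s v * inner v t_su)) *
      (sinh_rad s v * inner w X
        + (s / sqrt 2 * cosh_rad s v - sinh_rad s v) / (norm v)\<^sup>2 * inner v w * inner v X
        - s / sqrt 2 * sinh_rad s v * inner v w * inner X t_su)"
proof -
  define D where "D = cosh_rad s v - sinh_rad s v * inner v t_su"
  have D: "D > 0"
    unfolding D_def by (rule rad_denominators_pos)
  have Re_Im: "Re (corner' s v w) = - (sinh_rad' s v w * inner v y_su + sinh_rad s v * inner w y_su)"
    "Im (corner' s v w) = sinh_rad' s v w * inner v x_su + sinh_rad s v * inner w x_su"
    by (simp_all add: corner'_def)
  show ?thesis
    unfolding maurer_cartan_star_left[OF assms] pairing_upper sinh_rad'_def[symmetric] cosh_rad'_def[symmetric]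
      D_def[symmetric] inner_su2_coords[of w X] inner_su2_coords[of v X] Re_divide_of_real Im_divide_of_real Re_Im
    using s D
    by (simp add: divide_simps) (simp add: algebra_simps)
qed

section \<open>The deforming form\<close>

definition MC_pairing :: "real \<Rightarrow> su2 \<Rightarrow> su2 \<Rightarrow> su2 \<Rightarrow> real" where
  "MC_pairing s v w X = sqrt 2 / (s * (cosh_rad s v - sinh_rad s v * inner v t_su)) *
      (sinh_rad s v * inner w X
        + (s / sqrt 2 * cosh_rad s v - sinh_rad s v) / (norm v)\<^sup>2 * inner v w * inner v X
        - s / sqrt 2 * sinh_rad s v * inner v w * inner X t_su)"

lemma deforming_form_on_orbit:
  assumes "s > 0" "v \<noteq> 0" "deforming_form (\<lambda>b. ctranspose b ** b) s \<Omega>"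
  shows "blinfun_apply (blinfun_apply (\<Omega> (dual_basis v)) (dual_basis (lie_bracket X v))) (dual_basis w) =
    MC_pairing s v w X - inner w X"
  using deforming_form_dual_basis[OF assms(3)] pairing_maurer_cartan_star_left[OF assms(1,2)]
  by (simp add: MC_pairing_def)

text \<open>The splitting into orbit and radial directions, by the double cross product formula. The
  factor 2 compensates the 1 / sqrt 2 in each of the two brackets.\<close>

lemma orbit_decomposition:
  assumes "v \<noteq> 0"
  shows "a = lie_bracket ((2 / (norm v)\<^sup>2) *\<^sub>R lie_bracket v a) v + (inner v a / (norm v)\<^sup>2) *\<^sub>R v"
proof -
  have "(norm v)\<^sup>2 *\<^sub>R a = lie_bracket (2 *\<^sub>R lie_bracket v a) v + inner v a *\<^sub>R v"
    unfolding norm_su2_coords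
    by (simp add: su2_eq_iff_coords inner_left_distrib lie_bracket_coords
        inner_su2_coords[of v a] power2_eq_square field_simps sqrt_2_mult)
  then have "a = (1 / (norm v)\<^sup>2) *\<^sub>R (lie_bracket (2 *\<^sub>R lie_bracket v a) v + inner v a *\<^sub>R v)"
    using assms by (metis divideR_right norm_eq_zero power_eq_0_iff divide_inverse mult_1 scaleR_scaleR left_inverse scaleR_one)
  then show ?thesis
    by (simp add: scaleR_right_distrib lie_bracket.scaleR_left)
qed

(* The map B in the introductory comment. *)
definition sharp_shift :: "real \<Rightarrow> su2 \<Rightarrow> su2 \<Rightarrow> su2" where
  "sharp_shift s v a = sqrt 2 *\<^sub>R
    lie_bracket (((s * cosh_rad s v / sinh_rad s v - sqrt 2) / (norm v)\<^sup>2) *\<^sub>R v - s *\<^sub>R t_su) a"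

text \<open>Four vectors v, t, a, w in dimension three satisfy a linear relation with triple
  products as coefficients; this is its inner product with v.\<close>

lemma triple_product_identity:
  "inner v a * inner t (lie_bracket v w) - inner v w * inner t (lie_bracket v a) =
    (norm v)\<^sup>2 * inner t (lie_bracket a w) - inner v t * inner v (lie_bracket a w)"
  unfolding norm_su2_coords inner_su2_coords[of v a] inner_su2_coords[of v w] inner_su2_coords[of v t]
    inner_su2_coords[of _ "lie_bracket _ _"] lie_bracket_coords
  by (simp add: power2_eq_square field_simps)

text \<open>Writing s = sqrt 2 * \<sigma> removes the square roots, which leaves an identity between
  rational expressions to be checked.\<close>

lemma MC_pairing_scaled:
  assumes "\<sigma> > 0"
  shows "MC_pairing (sqrt 2 * \<sigma>) v w X =
    1 / (\<sigma> * (cosh_rad (sqrt 2 * \<sigma>) v - sinh_rad (sqrt 2 * \<sigma>) v * inner v t_su)) *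
      (sinh_rad (sqrt 2 * \<sigma>) v * inner w X
        + (\<sigma> * cosh_rad (sqrt 2 * \<sigma>) v - sinh_rad (sqrt 2 * \<sigma>) v) / (norm v)\<^sup>2 * inner v w * inner v X
        - \<sigma> * sinh_rad (sqrt 2 * \<sigma>) v * inner v w * inner X t_su)"
  using assms by (simp add: MC_pairing_def mult.assoc)

text \<open>The equation \<Omega>(a, w) = - MC(w, B a) reduced to scalars: \<alpha> = <v, a>,
  \<omega> = <v, w>, b = <v, t>, p = <t, [v, a]>, q = <t, [v, w]>, \<tau> = <v, [a, w]>, \<kappa> =
  <t, [a, w]>, R = |v|^2. The relation for R \<kappa> is the triple product identity. After it has
  eliminated \<kappa>, the terms with C \<omega> p cancel and C - S b = D absorbs b \<tau>.\<close>

lemma MC_pairing_scalar_identity: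
  fixes \<sigma> S R D C :: real
  assumes pos: "\<sigma> > 0" "S > 0" "R > 0" "D > 0" and C: "C = D + S * b"
    and \<kappa>: "R * \<kappa> = \<alpha> * q - \<omega> * p + b * \<tau>" and N: "N = 2 * (\<sigma> * C / S - 1) / R"
  shows "1 / (\<sigma> * D) * (S * (2 / R * \<tau>) - \<sigma> * S * \<omega> * (2 / R * p)) - 2 / R * \<tau>
      + \<alpha> / R * (1 / (\<sigma> * D) * (\<sigma> * S * R * (2 / R * q))) =
    - (1 / (\<sigma> * D) * (S * (N * \<tau> - 2 * \<sigma> * \<kappa>) + (\<sigma> * C - S) / R * \<omega> * (2 * \<sigma> * p) - \<sigma> * S * \<omega> * (N * p)))"
    (is "?l = - (1 / (\<sigma> * D) * ?r)")
proof -
  have SN: "S * N * R = 2 * (\<sigma> * C - S)"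
    unfolding N using pos by (simp add: field_simps)
  have "?r * R = (S * N * R) * (\<tau> - \<sigma> * \<omega> * p) - 2 * \<sigma> * S * (R * \<kappa>) + 2 * \<sigma> * \<omega> * p * (\<sigma> * C - S)"
    using pos by (simp add: field_simps)
  also have "\<dots> = 2 * (\<sigma> * D - S) * \<tau> - 2 * \<sigma> * S * (\<alpha> * q - \<omega> * p)"
    unfolding SN \<kappa> C by (simp add: algebra_simps)
  finally have "?r = (2 * (\<sigma> * D - S) * \<tau> - 2 * \<sigma> * S * (\<alpha> * q - \<omega> * p)) / R"
    using pos by (simp add: eq_divide_eq)
  then have "- (1 / (\<sigma> * D) * ?r) = - (1 / (\<sigma> * D) * ((2 * (\<sigma> * D - S) * \<tau> - 2 * \<sigma> * S * (\<alpha> * q - \<omega> * p)) / R))"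
    by simp
  also have "\<dots> = ?l"
    using pos by (simp add: field_simps)
  finally show ?thesis ..
qed

lemma deforming_form_eq_MC_pairing:
  assumes s: "s > 0" and v: "v \<noteq> 0" and \<Omega>: "deforming_form (\<lambda>b. ctranspose b ** b) s \<Omega>"
  shows "blinfun_apply (blinfun_apply (\<Omega> (dual_basis v)) (dual_basis a)) (dual_basis w) =
    - MC_pairing s v w (sharp_shift s v a)"
proof -
  define R where "R = (norm v)\<^sup>2"
  define Om where "Om a w = blinfun_apply (blinfun_apply (\<Omega> (dual_basis v)) (dual_basis a)) (dual_basis w)" for a w
  define X where "X a = (2 / R) *\<^sub>R lie_bracket v a" for a
  define M where "M = (s * cosh_rad s v / sinh_rad s v - sqrt 2) / R"
  define C where "C = cosh_rad s v"
  define S where "S = sinh_rad s v"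
  define D where "D = C - S * inner v t_su"
  have Om_orbit: "Om (lie_bracket X v) w = MC_pairing s v w X - inner w X" for X w
    unfolding Om_def by (rule deforming_form_on_orbit[OF s v \<Omega>])
  have Om_linear: "Om (a + b) w = Om a w + Om b w" "Om (r *\<^sub>R a) w = r * Om a w"
    "Om w (a + b) = Om w a + Om w b" "Om w (r *\<^sub>R a) = r * Om w a" for a b w r
    by (simp_all add: Om_def dual_basis_linear blinfun.bilinear_simps)
  have Om_alt: "Om a a = 0" for a
    unfolding Om_def by (rule deforming_form_alternating[OF \<Omega>])
  have Om_skew: "Om a b = - Om b a" for a b
    using Om_alt[of "a + b"] Om_alt[of a] Om_alt[of b] unfolding Om_linear by linarith
  have dec: "a = lie_bracket (X a) v + (inner v a / R) *\<^sub>R v" for a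
    unfolding R_def X_def by (rule orbit_decomposition[OF v])
  \<comment> \<open>The defining identity is silent about v in the first slot. Moving v to the
    second slot makes it speak, because the radial part of w contributes \<Omega>(v, v) = 0.\<close>
  have Om_v: "Om v w = inner v (X w) - MC_pairing s v v (X w)"
  proof -
    have "Om w v = Om (lie_bracket (X w) v + (inner v w / R) *\<^sub>R v) v"
      using dec[of w] by simp
    also have "\<dots> = MC_pairing s v v (X w) - inner v (X w)"
      by (simp add: Om_linear Om_alt Om_orbit)
    finally show ?thesis
      using Om_skew[of v w] by simp
  qed
  have "Om a w = Om (lie_bracket (X a) v + (inner v a / R) *\<^sub>R v) w"
    using dec[of a] by simp
  also have "\<dots> = MC_pairing s v w (X a) - inner w (X a)
      + inner v a / R * (inner v (X w) - MC_pairing s v v (X w))"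
    by (simp add: Om_linear Om_orbit Om_v)
  finally have 1: "Om a w = MC_pairing s v w (X a) - inner w (X a)
      + inner v a / R * (inner v (X w) - MC_pairing s v v (X w))" .
  define \<tau> where "\<tau> = inner v (lie_bracket a w)"
  define \<kappa> where "\<kappa> = inner t_su (lie_bracket a w)"
  define p where "p = inner t_su (lie_bracket v a)"
  define q where "q = inner t_su (lie_bracket v w)"
  have v_orth: "inner v (lie_bracket v b) = 0" for b
    by (subst inner_su2_coords) (simp add: lie_bracket_coords field_simps)
  have ip: "inner v (X b) = 0" "inner w (X a) = 2 / R * \<tau>" "inner (X a) t_su = 2 / R * p"
      "inner (X w) t_su = 2 / R * q" for b
    using inner_lie_bracket_cycle[of v a w] v_orth
    by (simp_all add: X_def \<tau>_def p_def q_def inner_commute)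
  have sh: "sharp_shift s v a = sqrt 2 *\<^sub>R lie_bracket (M *\<^sub>R v - s *\<^sub>R t_su) a"
    by (simp add: sharp_shift_def M_def R_def)
  have br: "inner w (lie_bracket b a) = inner b (lie_bracket a w)" for b
    by (metis inner_commute inner_lie_bracket_cycle)
  define \<sigma> where "\<sigma> = s / sqrt 2"
  have \<sigma>: "\<sigma> > 0" "s = sqrt 2 * \<sigma>"
    using s by (simp_all add: \<sigma>_def)
  define N where "N = sqrt 2 * M"
  have "inner u (sharp_shift s v a) =
      sqrt 2 * (M * inner u (lie_bracket v a) - s * inner u (lie_bracket t_su a))" for u
    unfolding sh by (simp add: lie_bracket.diff_left lie_bracket.scaleR_left inner_diff_right)
  moreover have "sqrt 2 * (M * inner u (lie_bracket v a) - s * inner u (lie_bracket t_su a)) =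
      N * inner u (lie_bracket v a) - 2 * \<sigma> * inner u (lie_bracket t_su a)" for u
    unfolding N_def \<sigma>(2) by (simp add: right_diff_distrib mult.assoc sqrt_2_mult)
  ultimately have inner_sh:
    "inner u (sharp_shift s v a) = N * inner u (lie_bracket v a) - 2 * \<sigma> * inner u (lie_bracket t_su a)" for u
    by simp
  have ip2: "inner w (sharp_shift s v a) = N * \<tau> - 2 * \<sigma> * \<kappa>"
    unfolding inner_sh br \<tau>_def \<kappa>_def ..
  have t_orth: "inner t_su (lie_bracket t_su a) = 0" "inner v (lie_bracket t_su a) = - p"
    unfolding p_def inner_su2_coords[of v "lie_bracket _ _"] inner_su2_coords[of t_su "lie_bracket _ _"] lie_bracket_coords
    by (simp_all add: su2_basis_inner field_simps)
  have ip3: "inner v (sharp_shift s v a) = 2 * \<sigma> * p" "inner (sharp_shift s v a) t_su = N * p"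
    unfolding inner_commute[of "sharp_shift s v a" t_su] inner_sh v_orth t_orth p_def[symmetric]
    by simp_all
  have pos: "S > 0" "R > 0" "D > 0"
    using v s rad_denominators_pos(1)[of s v] by (simp_all add: R_def S_def sinh_rad_def D_def C_def)
  have CD: "C = D + S * inner v t_su"
    by (simp add: D_def)
  have \<kappa>: "R * \<kappa> = inner v a * q - inner v w * p + inner v t_su * \<tau>"
    using triple_product_identity[of v a t_su w] unfolding \<tau>_def \<kappa>_def p_def q_def R_def by simp
  have N: "N = 2 * (\<sigma> * C / S - 1) / R"
    unfolding N_def M_def C_def[symmetric] S_def[symmetric]
    unfolding \<sigma>(2) using pos
    by (simp add: field_simps sqrt_2_mult)
  have MC: "MC_pairing s v u X = 1 / (\<sigma> * D) * (S * inner u X + (\<sigma> * C - S) / R * inner v u * inner v X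
      - \<sigma> * S * inner v u * inner X t_su)" for u X
    using MC_pairing_scaled[OF \<sigma>(1)] by (simp add: D_def C_def S_def R_def \<sigma>(2))
  have "Om a w = - MC_pairing s v w (sharp_shift s v a)"
    unfolding 1 MC ip ip2 ip3
    using MC_pairing_scalar_identity[OF \<sigma>(1) pos CD \<kappa> N]
    by (simp add: R_def power2_norm_eq_inner)
  then show ?thesis
    by (simp add: Om_def)
qed

text \<open>The Maurer-Cartan pairings from \<Omega>(a, w) and \<Omega>([B a, v], w) cancel, and a
  relation without E remains.\<close>

lemma deforming_form_sharp:
  assumes "s > 0" "v \<noteq> 0" "deforming_form (\<lambda>b. ctranspose b ** b) s \<Omega>"
  shows "blinfun_apply (blinfun_apply (\<Omega> (dual_basis v))
      (dual_basis (a + lie_bracket (sharp_shift s v a) v))) (dual_basis w) = - inner w (sharp_shift s v a)"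
  using deforming_form_eq_MC_pairing[OF assms] deforming_form_on_orbit[OF assms]
  by (simp add: dual_basis_linear blinfun.bilinear_simps)


section \<open>Bivectors and forms on the cotangent bundle\<close>

lemma bounded_bilinear_diff:
  assumes f: "bounded_bilinear f" and g: "bounded_bilinear g"
  shows "bounded_bilinear (\<lambda>x y. f x y - g x y)"
proof -
  interpret f: bounded_bilinear f by fact
  interpret g: bounded_bilinear g by fact
  obtain K where K: "\<And>x y. norm (f x y) \<le> norm x * norm y * K"
    using f.bounded by blast
  obtain L where L: "\<And>x y. norm (g x y) \<le> norm x * norm y * L"
    using g.bounded by blast
  have "norm (f x y - g x y) \<le> norm x * norm y * (K + L)" for x y
    using norm_triangle_ineq4[of "f x y" "g x y"] K[of x y] L[of x y] by (simp add: algebra_simps)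
  then show ?thesis
    by (intro bounded_bilinear.intro exI[of _ "K + L"])
      (auto simp: f.add_left f.add_right f.scaleR_left f.scaleR_right
        g.add_left g.add_right g.scaleR_left g.scaleR_right scaleR_right_diff_distrib)
qed

lemma bounded_bilinear_form2: "bounded_bilinear (\<lambda>u v. blinfun_apply (blinfun_apply B u) v)"
  by (rule bounded_bilinear.comp1[OF bounded_bilinear_blinfun_apply blinfun.bounded_linear_right])

lemma bilin_form2: "bilin (\<lambda>u v. blinfun_apply (blinfun_apply B u) v) = B"
  by (simp add: bilin_def blinfun_apply_inverse)

lemma wedge_apply:
  "blinfun_apply (blinfun_apply (wedge u v) \<alpha>) \<beta> =
    blinfun_apply \<alpha> u * blinfun_apply \<beta> v - blinfun_apply \<alpha> v * blinfun_apply \<beta> u"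
proof -
  have "bounded_bilinear (\<lambda>(\<alpha> :: 'a \<Rightarrow>\<^sub>L real) (\<beta> :: 'a \<Rightarrow>\<^sub>L real). \<alpha> a * \<beta> b)" for a b
    by (rule bounded_bilinear.comp[OF bounded_bilinear_mult blinfun.bounded_linear_left blinfun.bounded_linear_left])
  then show ?thesis
    unfolding wedge_def by (subst bilin_apply) (auto intro: bounded_bilinear_diff)
qed

lemma push_bivector_apply:
  "blinfun_apply (blinfun_apply (push_bivector A P) \<alpha>) \<beta> =
    blinfun_apply (blinfun_apply P (\<alpha> o\<^sub>L A)) (\<beta> o\<^sub>L A)"
proof -
  have "bounded_linear (\<lambda>\<alpha>. \<alpha> o\<^sub>L A)"
    by (rule bounded_bilinear.bounded_linear_left[OF bounded_bilinear_blinfun_compose])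
  then show ?thesis
    unfolding push_bivector_def by (intro bilin_apply bounded_bilinear.comp[OF bounded_bilinear_form2])
qed

text \<open>Solvability for every \<alpha> makes the flat map of \<omega> surjective, so
  \<open>inv\<close> is a right inverse. Skew-symmetry makes the choice of preimage irrelevant: as
  \<beta> is itself - \<omega>(W, -) for some W, its value on a preimage depends on the image
  only.\<close>

lemma poisson_bivector_eqI:
  assumes skew: "\<And>u v. blinfun_apply (blinfun_apply \<omega> u) v = - blinfun_apply (blinfun_apply \<omega> v) u"
    and sharp: "\<And>\<alpha>. \<exists>V. (\<forall>u. blinfun_apply (blinfun_apply \<omega> V) u = - blinfun_apply \<alpha> u) \<and>
      (\<forall>\<beta>. blinfun_apply (blinfun_apply P \<alpha>) \<beta> = blinfun_apply \<beta> V)"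
  shows "poisson_bivector \<omega> = P"
proof -
  have "blinfun_apply \<beta> (- inv (blinfun_apply \<omega>) \<alpha>) = blinfun_apply (blinfun_apply P \<alpha>) \<beta>" for \<alpha> \<beta>
  proof -
    obtain V where V: "\<And>u. blinfun_apply (blinfun_apply \<omega> V) u = - blinfun_apply \<alpha> u"
      "\<And>\<beta>. blinfun_apply (blinfun_apply P \<alpha>) \<beta> = blinfun_apply \<beta> V"
      using sharp[of \<alpha>] by blast
    obtain W where W: "\<And>u. blinfun_apply (blinfun_apply \<omega> W) u = - blinfun_apply \<beta> u"
      using sharp[of \<beta>] by blast
    have "blinfun_apply \<omega> (- V) = \<alpha>"
      by (rule blinfun_eqI) (simp add: V blinfun.bilinear_simps)
    then have "blinfun_apply \<omega> (inv (blinfun_apply \<omega>) \<alpha>) = blinfun_apply \<omega> (- V)"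
      by (simp add: f_inv_into_f[OF range_eqI[of \<alpha> "blinfun_apply \<omega>" "- V"]])
    then have "blinfun_apply (blinfun_apply \<omega> W) (inv (blinfun_apply \<omega>) \<alpha>) = blinfun_apply (blinfun_apply \<omega> W) (- V)"
      by (simp only: skew[of W])
    then show ?thesis
      unfolding W V by (simp add: blinfun.bilinear_simps)
  qed
  then show ?thesis
    by (simp add: poisson_bivector_def bilin_form2)
qed

section \<open>The canonical form, its deformation and skew-symmetry\<close>

lemma omega_can_apply:
  assumes "k \<in> SU2"
  shows "blinfun_apply (blinfun_apply (omega_can (k, \<xi>)) u) v =
    blinfun_apply (snd v) (fst u) - blinfun_apply (snd u) (fst v) + blinfun_apply \<xi> (lie_bracket (fst u) (fst v))"
proof -
  have eq: "dir_deriv (\<lambda>q. theta_taut q v) (k, \<xi>) u - dir_deriv (\<lambda>q. theta_taut q u) (k, \<xi>) v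
      - theta_taut (k, \<xi>) (lie_bracket (fst u) (fst v), 0) =
    blinfun_apply (snd u) (fst v) - blinfun_apply (snd v) (fst u) - blinfun_apply \<xi> (lie_bracket (fst u) (fst v))" for u v
    by (cases u; cases v) (simp add: dir_deriv_theta_taut[OF assms] theta_taut_apply[OF assms])
  have 1: "bounded_bilinear (\<lambda>u v :: cot_tangent. blinfun_apply (snd u) (fst v))"
    by (intro bounded_bilinear.comp[OF bounded_bilinear_blinfun_apply] bounded_linear_fst bounded_linear_snd)
  have 2: "bounded_bilinear (\<lambda>u v :: cot_tangent. blinfun_apply \<xi> (lie_bracket (fst u) (fst v)))"
  proof -
    have "bounded_bilinear (\<lambda>x y. \<xi> (lie_bracket x y))"
      by (intro bilinear_conv_bounded_bilinear[THEN iffD1])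
        (auto simp: bilinear_def lie_bracket.add_left lie_bracket.add_right lie_bracket.scaleR_left
          lie_bracket.scaleR_right blinfun.bilinear_simps intro!: linearI)
    then show ?thesis
      by (rule bounded_bilinear.comp) (intro bounded_linear_fst)+
  qed
  have "bounded_bilinear (\<lambda>u v :: cot_tangent. blinfun_apply (snd u) (fst v) - blinfun_apply (snd v) (fst u)
      - blinfun_apply \<xi> (lie_bracket (fst u) (fst v)))"
    using bounded_bilinear_diff[OF bounded_bilinear_diff[OF 1 bounded_bilinear.flip[OF 1]] 2] by simp
  then show ?thesis
    unfolding omega_can_def ext_deriv_def eq by (simp add: bilin_apply blinfun.bilinear_simps)
qed

lemma pullback_mu_L_apply:
  assumes "k \<in> SU2"
  shows "blinfun_apply (blinfun_apply (pullback_mu_L \<Omega> (k, dual_basis v)) u) u' =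
    blinfun_apply (blinfun_apply (\<Omega> (dual_basis (blinfun_apply (Ad k) v)))
      (dual_basis (blinfun_apply (Ad k) (lie_bracket (fst u) v + phi (snd u)))))
      (dual_basis (blinfun_apply (Ad k) (lie_bracket (fst u') v + phi (snd u'))))"
proof -
  let ?d = "\<lambda>u. dual_basis (blinfun_apply (Ad k) (lie_bracket (fst u) v + phi (snd u)))"
  have d: "dir_deriv mu_L (k, dual_basis v) u = ?d u" for u
    by (cases u) (simp add: dir_deriv_mu_L[OF assms])
  have "bounded_linear ?d"
    by (intro bounded_linear_compose[OF bounded_linear_dual_basis] bounded_linear_compose[OF blinfun.bounded_linear_right]
        bounded_linear_add bounded_linear_compose[OF lie_bracket.bounded_linear_left]
        bounded_linear_compose[OF bounded_linear_phi] bounded_linear_fst bounded_linear_snd)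
  then show ?thesis
    unfolding pullback_mu_L_def d using assms
    by (subst bilin_apply) (auto intro!: bounded_bilinear.comp[OF bounded_bilinear_form2] simp: mu_L_def coAd_dual_basis)
qed

lemma deform_skew:
  assumes "k \<in> SU2" and \<Omega>: "\<And>\<zeta> \<eta>. blinfun_apply (blinfun_apply (\<Omega> \<zeta>) \<eta>) \<eta> = 0"
  shows "blinfun_apply (blinfun_apply (deform \<Omega> omega_can (k, dual_basis v)) u) u' =
    - blinfun_apply (blinfun_apply (deform \<Omega> omega_can (k, dual_basis v)) u') u"
proof -
  have "blinfun_apply (blinfun_apply (\<Omega> \<zeta>) \<eta>) \<theta> = - blinfun_apply (blinfun_apply (\<Omega> \<zeta>) \<theta>) \<eta>" for \<zeta> \<eta> \<theta>
    using \<Omega>[of \<zeta> "\<eta> + \<theta>"] \<Omega>[of \<zeta> \<eta>] \<Omega>[of \<zeta> \<theta>] unfolding blinfun.bilinear_simps by linarith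
  then have "blinfun_apply (blinfun_apply (pullback_mu_L \<Omega> (k, dual_basis v)) u) u' =
      - blinfun_apply (blinfun_apply (pullback_mu_L \<Omega> (k, dual_basis v)) u') u"
    unfolding pullback_mu_L_apply[OF assms(1)] .
  then show ?thesis
    by (simp add: deform_def blinfun.bilinear_simps omega_can_apply[OF assms(1)]
        lie_bracket_anticommute[of "fst u'" "fst u"])
qed

section \<open>Evaluating the terms of the bivector on covectors\<close>

lemma left_ext_apply: "k \<in> SU2 \<Longrightarrow> blinfun_apply (left_ext k) X = (X, 0)"
  by (simp add: left_ext_def bounded_linear_Blinfun_apply bounded_linear_Pair)

text \<open>X k = k (k^{-1} X k), hence the inverse adjoint action in the left
  trivialization.\<close>

lemma right_ext_apply: "k \<in> SU2 \<Longrightarrow> blinfun_apply (right_ext k) X = (blinfun_apply (Ad (ctranspose k)) X, 0)"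
  by (simp add: right_ext_def left_triv_right bounded_linear_Blinfun_apply bounded_linear_Pair
      blinfun.bounded_linear_right)

lemma covector_coords:
  fixes \<alpha> :: "cot_tangent \<Rightarrow>\<^sub>L real"
  obtains p q where "\<And>X w. blinfun_apply \<alpha> (X, dual_basis w) = inner p X + inner q w"
    "\<And>X. blinfun_apply \<alpha> (X, 0) = inner p X" "\<And>w. blinfun_apply \<alpha> (0, dual_basis w) = inner q w"
proof -
  have 1: "bounded_linear (\<lambda>X :: su2. blinfun_apply \<alpha> (X, 0))"
    "bounded_linear (\<lambda>w. blinfun_apply \<alpha> (0, dual_basis w))"
    by (intro bounded_linear_compose[OF blinfun.bounded_linear_right] bounded_linear_Pair
        bounded_linear_ident bounded_linear_zero bounded_linear_dual_basis)+
  define p where "p = phi (Blinfun (\<lambda>X. blinfun_apply \<alpha> (X, 0)))"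
  define q where "q = phi (Blinfun (\<lambda>w. blinfun_apply \<alpha> (0, dual_basis w)))"
  have 2: "blinfun_apply \<alpha> (X, 0) = inner p X" "blinfun_apply \<alpha> (0, dual_basis w) = inner q w" for X w
    unfolding p_def q_def inner_phi using 1 by (simp_all add: bounded_linear_Blinfun_apply)
  have "blinfun_apply \<alpha> (X, dual_basis w) = inner p X + inner q w" for X w
    using blinfun.add_right[of \<alpha> "(X, 0)" "(0, dual_basis w)"] by (simp add: 2)
  with 2 show ?thesis
    by (rule that[rotated])
qed

text \<open>Contracting x wedge y with p gives p_x y - p_y x = sqrt 2 [t, p], and Ad h transports
  this. It turns both the first term of the bivector and the r-matrix terms into brackets comparable
  with B.\<close>

lemma Ad_basis_wedge:
  assumes "h \<in> SU2"
  shows "inner p (blinfun_apply (Ad h) x_su) * inner q (blinfun_apply (Ad h) y_su)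
      - inner p (blinfun_apply (Ad h) y_su) * inner q (blinfun_apply (Ad h) x_su) =
    sqrt 2 * inner q (lie_bracket (blinfun_apply (Ad h) t_su) p)"
proof -
  define p' where "p' = blinfun_apply (Ad (ctranspose h)) p"
  define q' where "q' = blinfun_apply (Ad (ctranspose h)) q"
  have pq: "p = blinfun_apply (Ad h) p'" "q = blinfun_apply (Ad h) q'"
    by (simp_all add: p'_def q'_def Ad_ctranspose_inverse[OF assms])
  have "inner p' x_su * inner q' y_su - inner p' y_su * inner q' x_su = sqrt 2 * inner q' (lie_bracket t_su p')"
    unfolding inner_su2_coords[of q' "lie_bracket _ _"] lie_bracket_coords
    by (simp add: su2_basis_inner field_simps)
  then show ?thesis
    unfolding pq Ad_lie_bracket[OF assms, symmetric] inner_Ad[OF assms] .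
qed

section \<open>Inverting the deformed form\<close>

lemma norm_Ad: "k \<in> SU2 \<Longrightarrow> norm (blinfun_apply (Ad k) v) = norm v"
  by (simp add: norm_eq_sqrt_inner inner_Ad)

text \<open>The radial coefficient depends on |v| only and is invariant, but the fixed vector t is
  not: pulled back to the point itself it becomes Ad_{k^{-1}} t.\<close>

lemma Ad_sharp_shift:
  assumes "k \<in> SU2"
  defines "e \<equiv> blinfun_apply (Ad (ctranspose k)) t_su"
  shows "sharp_shift s (blinfun_apply (Ad k) v) (blinfun_apply (Ad k) p) = blinfun_apply (Ad k)
    (sqrt 2 *\<^sub>R lie_bracket (((s * cosh_rad s v / sinh_rad s v - sqrt 2) / (norm v)\<^sup>2) *\<^sub>R v - s *\<^sub>R e) p)"
proof -
  have "blinfun_apply (Ad k) e = t_su"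
    by (simp add: e_def Ad_ctranspose_inverse[OF assms(1)])
  then show ?thesis
    by (simp add: sharp_shift_def norm_Ad[OF assms(1)] cosh_rad_def sinh_rad_def Ad_lie_bracket[OF assms(1)]
        blinfun.bilinear_simps)
qed

lemma deform_sharp:
  fixes p q :: su2
  assumes k: "k \<in> SU2" and s: "s > 0" and v: "v \<noteq> 0"
    and \<Omega>: "deforming_form (\<lambda>b. ctranspose b ** b) s \<Omega>"
  defines "e \<equiv> blinfun_apply (Ad (ctranspose k)) t_su"
  defines "Y \<equiv> sqrt 2 *\<^sub>R lie_bracket (((s * cosh_rad s v / sinh_rad s v - sqrt 2) / (norm v)\<^sup>2) *\<^sub>R v - s *\<^sub>R e) p"
  shows "blinfun_apply (blinfun_apply (deform \<Omega> omega_can (k, dual_basis v)) (Y - q, dual_basis (p + lie_bracket q v)))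
      (Z, dual_basis z) = - (inner p Z + inner q z)"
proof -
  have Y: "blinfun_apply (Ad k) Y = sharp_shift s (blinfun_apply (Ad k) v) (blinfun_apply (Ad k) p)"
    unfolding Y_def e_def Ad_sharp_shift[OF k] ..
  have v': "blinfun_apply (Ad k) v \<noteq> 0"
    using v norm_Ad[OF k, of v] by (metis norm_eq_zero)
  \<comment> \<open>The contributions of q cancel: (-q, [q, v]) is tangent to the fibres of
    \<open>mu_L\<close>. What remains has the form that \<open>deforming_form_sharp\<close>
    evaluates.\<close>
  have "lie_bracket (Y - q) v + (p + lie_bracket q v) = p + lie_bracket Y v"
    by (simp add: lie_bracket.diff_left)
  then have "blinfun_apply (blinfun_apply (pullback_mu_L \<Omega> (k, dual_basis v)) (Y - q, dual_basis (p + lie_bracket q v)))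
      (Z, dual_basis z) = - inner (blinfun_apply (Ad k) (lie_bracket Z v + z)) (blinfun_apply (Ad k) Y)"
    unfolding pullback_mu_L_apply[OF k] Y using deforming_form_sharp[OF s v' \<Omega>, of "blinfun_apply (Ad k) p"]
    by (simp add: blinfun.bilinear_simps Ad_lie_bracket[OF k] Y add.commute)
  also have "\<dots> = - inner (lie_bracket Z v + z) Y"
    by (simp add: inner_Ad[OF k])
  finally have 1: "blinfun_apply (blinfun_apply (pullback_mu_L \<Omega> (k, dual_basis v)) (Y - q, dual_basis (p + lie_bracket q v)))
      (Z, dual_basis z) = - inner (lie_bracket Z v + z) Y" .
  have "inner (lie_bracket q v) Z = - inner v (lie_bracket q Z)"
    "inner v (lie_bracket Y Z) = inner (lie_bracket Z v) Y"
    using inner_lie_bracket_cycle[of v q Z] inner_lie_bracket_cycle[of Z v Y]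
      lie_bracket_anticommute[of q v] inner_lie_bracket_cycle[of v Y Z]
    by (simp_all add: inner_commute)
  then show ?thesis
    unfolding deform_def plus_blinfun.rep_eq 1 omega_can_apply[OF k]
    by (simp add: inner_left_distrib inner_diff_right lie_bracket.diff_left inner_commute[of z])
qed

text \<open>The origin of \<gamma>: with u = sqrt 2 s c one has s - 1 / \<gamma> = s (e^u + 1) /
  (e^u - 1) = s coth (u / 2), and u / 2 = (s / sqrt 2) c is the argument in
  \<open>cosh_rad\<close>.\<close>

lemma coth_rad_eq_gamma:
  assumes s: "s > 0" and c: "norm v = c" "c > 0" and \<gamma>: "\<gamma> = (1 - exp (sqrt 2 * s * c)) / (2 * s)"
  shows "(s * cosh_rad s v / sinh_rad s v - sqrt 2) / (norm v)\<^sup>2 = (s - (1 / \<gamma> + sqrt 2 / c)) / c"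
proof -
  define E where "E = exp (s / sqrt 2 * c)"
  have "s / sqrt 2 * c + s / sqrt 2 * c = sqrt 2 * s * c"
    by (simp add: field_simps sqrt_2_mult)
  then have E2: "exp (sqrt 2 * s * c) = E * E"
    unfolding E_def exp_add[symmetric] by simp
  have E: "E > 1"
    using s c by (simp add: E_def)
  then have E': "E * E > 1"
    using less_1_mult by blast
  have inv: "exp (- (s / sqrt 2 * c)) = 1 / E"
    by (simp add: E_def exp_minus divide_inverse)
  have "cosh_rad s v / sinh_rad s v = c * ((E + 1 / E) / (E - 1 / E))"
    unfolding cosh_rad_def sinh_rad_def c(1) cosh_def sinh_def inv E_def[symmetric] by simp
  also have "(E + 1 / E) / (E - 1 / E) = (E * E + 1) / (E * E - 1)"
    using E E' by (simp add: divide_simps)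
  finally have "s * (cosh_rad s v / sinh_rad s v) = s * (c * ((E * E + 1) / (E * E - 1)))"
    by (rule arg_cong)
  then have 1: "s * cosh_rad s v / sinh_rad s v = s * c * ((E * E + 1) / (E * E - 1))"
    by (simp add: mult.assoc)
  have "s - 1 / \<gamma> = s * ((E * E + 1) / (E * E - 1))"
    unfolding \<gamma> E2 using s E' by (simp add: divide_simps) (simp add: algebra_simps)
  then have "s - (1 / \<gamma> + sqrt 2 / c) = s * ((E * E + 1) / (E * E - 1)) - sqrt 2 / c"
    by simp
  then show ?thesis
    unfolding 1 c(1) using c(2) by (simp add: field_simps power2_eq_square)
qed

theorem proposition5p7:
  fixes k h :: mat2 and \<xi> lam :: su2_dual and s c \<gamma> :: real
    and f :: "mat2 \<Rightarrow> mat2" and \<Omega> :: "su2_dual \<Rightarrow> su2_dual form2"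
  assumes "s > 0"
    and "f_convention f"
    and "deforming_form f s \<Omega>"
    and "k \<in> SU2" and "\<xi> \<noteq> 0"
    and "h \<in> SU2"
    and "lam = c *\<^sub>R dual_basis t_su" and "c > 0" and "lam \<in> weyl_chamber"
    and "\<xi> = coAd h lam"
    and "\<gamma> = (1 - exp (sqrt 2 * s * c)) / (2 * s)"
  shows "poisson_bivector (deform \<Omega> omega_can (k, \<xi>)) =
      - ((1 / \<gamma> + sqrt 2 / c) *\<^sub>R
          wedge (left_ext k (blinfun_apply (Ad h) x_su)) (left_ext k (blinfun_apply (Ad h) y_su)))
      + (\<Sum>b\<in>su2_basis. wedge (left_ext k b) (const_field (dual_basis b)))
      - (1 / 2) *\<^sub>R (\<Sum>a\<in>su2_basis. \<Sum>b\<in>su2_basis.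
          blinfun_apply \<xi> (lie_bracket a b) *\<^sub>R
            wedge (const_field (dual_basis a)) (const_field (dual_basis b)))
      + push_bivector (right_ext k) (push_bivector (Ad (k ** h)) (r_matrix s) - r_matrix s)"
    (is "_ = ?P")
proof -
  note k = \<open>k \<in> SU2\<close> and h = \<open>h \<in> SU2\<close>
  have \<Omega>: "deforming_form (\<lambda>b. ctranspose b ** b) s \<Omega>"
    using assms(1-3) not_deforming_form_star_right by (auto simp: f_convention_def)
  define v where "v = c *\<^sub>R blinfun_apply (Ad h) t_su"
  define e where "e = blinfun_apply (Ad (ctranspose k)) t_su"
  define \<kappa> where "\<kappa> = 1 / \<gamma> + sqrt 2 / c"
  have \<xi>: "\<xi> = dual_basis v"
    using assms(7,10) h by (simp add: v_def coAd_dual_basis blinfun.bilinear_simps flip: dual_basis_linear(4))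
  have norm_v: "norm v = c"
    using \<open>c > 0\<close> by (simp add: v_def norm_Ad[OF h] norm_t_su)
  then have "v \<noteq> 0"
    using \<open>c > 0\<close> by auto
  \<comment> \<open>The factor c in v cancels the outer division by c, leaving a multiple of the
    unit vector Ad_h t.\<close>
  have ht: "((s * cosh_rad s v / sinh_rad s v - sqrt 2) / (norm v)\<^sup>2) *\<^sub>R v = (s - \<kappa>) *\<^sub>R blinfun_apply (Ad h) t_su"
    unfolding coth_rad_eq_gamma[OF assms(1) norm_v assms(8,11)] \<kappa>_def[symmetric]
    using \<open>c > 0\<close> by (simp add: v_def)
  have "\<exists>V. (\<forall>u. blinfun_apply (blinfun_apply (deform \<Omega> omega_can (k, \<xi>)) V) u = - blinfun_apply \<alpha> u) \<and>
      (\<forall>\<beta>. blinfun_apply (blinfun_apply ?P \<alpha>) \<beta> = blinfun_apply \<beta> V)" for \<alpha>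
  proof -
    obtain p q where \<alpha>: "\<And>X w. blinfun_apply \<alpha> (X, dual_basis w) = inner p X + inner q w"
      "\<And>X. blinfun_apply \<alpha> (X, 0) = inner p X" "\<And>w. blinfun_apply \<alpha> (0, dual_basis w) = inner q w"
      using covector_coords[of \<alpha>] by blast
    \<comment> \<open>The part with \<kappa> will match the first wedge of the claim, the difference
      s Ad_h t - s e the r-matrix term.\<close>
    define Y where "Y = sqrt 2 *\<^sub>R lie_bracket ((s - \<kappa>) *\<^sub>R blinfun_apply (Ad h) t_su - s *\<^sub>R e) p"
    define V where "V = (Y - q, dual_basis (p + lie_bracket q v))"
    have "blinfun_apply (blinfun_apply (deform \<Omega> omega_can (k, \<xi>)) V) u = - blinfun_apply \<alpha> u" for u
    proof -
      obtain Z z where u: "u = (Z, dual_basis z)"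
        by (metis dual_basis_phi prod.collapse)
      show ?thesis
        using deform_sharp[OF k assms(1) \<open>v \<noteq> 0\<close> \<Omega>, of p q Z z]
        unfolding ht e_def[symmetric] Y_def[symmetric] V_def[symmetric] u \<xi> \<alpha> .
    qed
    moreover have "blinfun_apply (blinfun_apply ?P \<alpha>) \<beta> = blinfun_apply \<beta> V" for \<beta>
    proof -
      obtain p' q' where \<beta>: "\<And>X w. blinfun_apply \<beta> (X, dual_basis w) = inner p' X + inner q' w"
        "\<And>X. blinfun_apply \<beta> (X, 0) = inner p' X" "\<And>w. blinfun_apply \<beta> (0, dual_basis w) = inner q' w"
        using covector_coords[of \<beta>] by blast
      let ?ap = "\<lambda>P. blinfun_apply (blinfun_apply P \<alpha>) \<beta>"
      have 1: "?ap (wedge (left_ext k (blinfun_apply (Ad h) x_su)) (left_ext k (blinfun_apply (Ad h) y_su))) =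
          sqrt 2 * inner p' (lie_bracket (blinfun_apply (Ad h) t_su) p)"
        unfolding wedge_apply left_ext_apply[OF k] \<alpha> \<beta> by (rule Ad_basis_wedge[OF h])
      have 2: "?ap (\<Sum>b\<in>su2_basis. wedge (left_ext k b) (const_field (dual_basis b))) = inner p q' - inner q p'"
        unfolding sum_su2_basis plus_blinfun.rep_eq wedge_apply left_ext_apply[OF k] const_field_def \<alpha> \<beta>
          inner_su2_coords[of p q'] inner_su2_coords[of q p']
        by (simp add: algebra_simps)
      \<comment> \<open>Exchanging a and b flips both the bracket and the wedge, so each pair counts
        twice; the resulting 2 meets the factor 1/2 of the claim.\<close>
      have 3: "?ap (\<Sum>a\<in>su2_basis. \<Sum>b\<in>su2_basis. blinfun_apply \<xi> (lie_bracket a b) *\<^sub>R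
            wedge (const_field (dual_basis a)) (const_field (dual_basis b))) = - 2 * inner q' (lie_bracket q v)"
        unfolding sum_su2_basis plus_blinfun.rep_eq scaleR_blinfun.rep_eq wedge_apply const_field_def \<alpha> \<beta> \<xi>
          dual_basis_apply inner_su2_coords[of v "lie_bracket _ _"] inner_su2_coords[of q' "lie_bracket _ _"] lie_bracket_coords
        by (simp add: su2_basis_inner field_simps sqrt_2_mult)
      \<comment> \<open>Right-invariant extension applies Ad_{k^{-1}}, which reduces Ad_{kh} to Ad_h
        in the first part and replaces t by e in the second.\<close>
      have 4: "?ap (push_bivector (right_ext k) (push_bivector (Ad (k ** h)) (r_matrix s) - r_matrix s)) =
          s * sqrt 2 * inner p' (lie_bracket (blinfun_apply (Ad h) t_su) p) - s * sqrt 2 * inner p' (lie_bracket e p)"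
      proof -
        have R: "blinfun_apply (\<theta> o\<^sub>L right_ext k) X = blinfun_apply \<theta> (blinfun_apply (Ad (ctranspose k)) X, 0)" for \<theta> :: "cot_tangent \<Rightarrow>\<^sub>L real" and X
          by (simp add: right_ext_apply[OF k])
        have Rh: "blinfun_apply ((\<theta> o\<^sub>L right_ext k) o\<^sub>L Ad (k ** h)) X = blinfun_apply \<theta> (blinfun_apply (Ad h) X, 0)" for \<theta> :: "cot_tangent \<Rightarrow>\<^sub>L real" and X
          by (simp add: right_ext_apply[OF k] Ad_mult[OF k h] Ad_ctranspose_inverse[OF k])
        show ?thesis
          unfolding push_bivector_apply minus_blinfun.rep_eq r_matrix_def scaleR_blinfun.rep_eq wedge_apply R Rh \<alpha> \<beta>
            Ad_basis_wedge[OF h] Ad_basis_wedge[OF SU2_ctranspose[OF k]] e_def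
          by simp
      qed
      have "?ap ?P = - (\<kappa> * (sqrt 2 * inner p' (lie_bracket (blinfun_apply (Ad h) t_su) p)))
          + (inner p q' - inner q p') - 1 / 2 * (- 2 * inner q' (lie_bracket q v))
          + (s * sqrt 2 * inner p' (lie_bracket (blinfun_apply (Ad h) t_su) p) - s * sqrt 2 * inner p' (lie_bracket e p))"
        unfolding plus_blinfun.rep_eq minus_blinfun.rep_eq uminus_blinfun.rep_eq scaleR_blinfun.rep_eq 1 2 3 4 \<kappa>_def
        by simp
      also have "\<dots> = blinfun_apply \<beta> V"
        unfolding V_def \<beta> Y_def
        by (simp add: lie_bracket.add_left lie_bracket.diff_left lie_bracket.scaleR_left inner_diff_right inner_right_distrib
            inner_commute[of p] inner_commute[of q p'] algebra_simps)
      finally show ?thesis .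
    qed
    ultimately show ?thesis
      by blast
  qed
  moreover have "blinfun_apply (blinfun_apply (deform \<Omega> omega_can (k, \<xi>)) u) u' =
      - blinfun_apply (blinfun_apply (deform \<Omega> omega_can (k, \<xi>)) u') u" for u u'
    unfolding \<xi> by (rule deform_skew[OF k deforming_form_alternating[OF \<Omega>]])
  ultimately show ?thesis
    by (intro poisson_bivector_eqI)
qed

end
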